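(* (i) There exists a constant $K$ such that if $m=m(n)$ is an integer with $Kn\log n\le m\le\binom n2$, then $$\lim_{\substack{n\to\infty\\ n\text{ even}}}\Pr\left[G^{(n)}_{n,m}\text{ contains a rainbow Hamilton cycle}\right]=1.$$ (ii) For every function $\omega=\omega(n)\to\infty$ (growing arbitrarily slowly), if $m=\omega n\log n$ with $m\le\binom n2$, then $$\lim_{\substack{n\to\infty\\ n\text{ odd}}}\Pr\left[G^{(n)}_{n,m}\text{ contains a rainbow Hamilton cycle}\right]=1.$$
   Context: $G^{(n)}_{n,m}$ (also written $G_{n,m;n}$) is the random edge-colored graph on vertex set $[n]=\{1,\dots,n\}$ obtained by choosing a set of $m$ edges uniformly at random from all $m$-element subsets of the $\binom n2$ possible edges and then giving each chosen edge an independent uniformly random color from a set of $n$ colors. A set of edges is rainbow if its edges have pairwise different colors; a rainbow Hamilton cycle is a Hamilton cycle whose edge set is rainbow. Here $\log$ is the natural logarithm and $m$ is an integer (so $\omega n\log n$ is assumed to be an integer). *)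

theory Defs
  imports "HOL-Probability.Probability"
begin

definition all_edges :: "nat \<Rightarrow> nat set set" where
  "all_edges n = {e. e \<subseteq> {1..n} \<and> card e = 2}"

text \<open>
  The random edge-coloured graph with \<open>m\<close> edges and \<open>q\<close> colours, as a distribution of pairs
  \<open>(E, c)\<close> of an edge set and a colouring. Given \<open>E\<close>, the colours of the edges of \<open>E\<close> are
  independent and uniform on \<open>{1..q}\<close>; outside \<open>E\<close> the function \<open>c\<close> takes the dummy value \<open>0\<close>.
  Only meaningful for \<open>m \<le> n choose 2\<close> (and \<open>q \<ge> 1\<close> if \<open>m > 0\<close>), since \<^const>\<open>pmf_of_set\<close> is
  unspecified on the empty set.
\<close>

definition random_coloured_graph ::
    "nat \<Rightarrow> nat \<Rightarrow> nat \<Rightarrow> (nat set set \<times> (nat set \<Rightarrow> nat)) pmf" where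
  "random_coloured_graph n m q =
     do {
       E \<leftarrow> pmf_of_set {E. E \<subseteq> all_edges n \<and> card E = m};
       c \<leftarrow> Pi_pmf E 0 (\<lambda>_. pmf_of_set {1..q});
       return_pmf (E, c)
     }"

text \<open>The edges of the closed walk through the vertices \<open>vs\<close>, including the closing edge.\<close>

definition cycle_edges :: "nat list \<Rightarrow> nat set set" where
  "cycle_edges vs = {{vs ! i, vs ! (Suc i mod length vs)} | i. i < length vs}"

definition hamilton_cycle :: "nat \<Rightarrow> nat set set \<Rightarrow> bool" where
  "hamilton_cycle n C \<longleftrightarrow>
     (\<exists>vs. distinct vs \<and> set vs = {1..n} \<and> length vs \<ge> 3 \<and> C = cycle_edges vs)"

definition rainbow :: "(nat set \<Rightarrow> nat) \<Rightarrow> nat set set \<Rightarrow> bool" where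
  "rainbow c F \<longleftrightarrow> inj_on c F"

definition has_rainbow_hamilton_cycle :: "nat \<Rightarrow> nat set set \<Rightarrow> (nat set \<Rightarrow> nat) \<Rightarrow> bool" where
  "has_rainbow_hamilton_cycle n E c \<longleftrightarrow> (\<exists>C. hamilton_cycle n C \<and> C \<subseteq> E \<and> rainbow c C)"

definition prob_rainbow_hamilton :: "nat \<Rightarrow> nat \<Rightarrow> real" where
  "prob_rainbow_hamilton n m =
     measure_pmf.prob (random_coloured_graph n m n)
       {(E, c). has_rainbow_hamilton_cycle n E c}"

text \<open>The filters of \<open>n \<rightarrow> \<infinity>\<close> through the even, respectively odd, numbers.\<close>

definition even_at_top :: "nat filter" where
  "even_at_top = inf at_top (principal {n. even n})"

definition odd_at_top :: "nat filter" where
  "odd_at_top = inf at_top (principal {n. odd n})"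

end

theory Submission
  imports Defs
begin

text \<open>
  A rainbow Hamilton cycle is a set of \<open>n\<close> pairs (edge, colour) in \<open>X = all_edges n \<times> {1..n}\<close>,
  and the proof treats it as a member of a family of subsets of \<open>X\<close>. List the vertices in a
  uniformly random cyclic order and give the \<open>n\<close> edges of the resulting cycle the \<open>n\<close> colours in
  a uniformly random order. A prescribed set of \<open>t\<close> pairs belongs to this coloured cycle with
  probability at most \<open>\<kappa> ^ (- t)\<close>, where \<open>\<kappa> = n\<^sup>2 / 36\<close>: each prescribed edge costs a factor
  of order \<open>1 / n\<close>, and so does its colour (\<open>rainbow_cycles_spread\<close>). In other words, the family
  is \<open>\<kappa>\<close>-spread.

  For a \<open>\<kappa>\<close>-spread family of sets of size at most \<open>l\<close>, a random subset of \<open>X\<close> of density of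
  order \<open>log l / \<kappa>\<close> contains a member with probability close to \<open>1\<close>. This is the fractional
  Kahn-Kalai theorem of Frankston, Kahn, Narayanan and Park, and \<open>spread_family_covered\<close> is the
  version used here, proved with the minimal fragments of Park and Pham. The random subset is
  revealed in about \<open>log l\<close> rounds; after each round a typical member of the family can be replaced
  by another one that is covered by the revealed part together with the first, and of which at most
  half as many elements are still missing. With \<open>\<kappa> = n\<^sup>2 / 36\<close> the density is of order
  \<open>log n / n\<^sup>2\<close>, that is, of order \<open>n log n\<close> random pairs.

  In a random set of pairs an edge may receive several colours, whereas in a random coloured graph
  it has only one. A comparison due to McDiarmid repairs this: one edge at a time, replace the
  independent choice of its colours by the choice of at most one colour, each colour keeping its
  probability. A coloured cycle uses an edge with one colour only, so at every replacement
  the probability of containing a cycle can only grow (\<open>exclusive_le_independent\<close>).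

  The graph obtained in this way has a binomial number of edges and is, given this number, a random
  coloured graph. The probability of failure decreases with the number of edges, and a binomial
  variable of mean at most \<open>m / 2\<close> is at most \<open>m\<close> with probability at least \<open>1/2\<close>; hence fixing the
  number of edges to be \<open>m\<close> costs at most a factor \<open>2\<close> (\<open>bad_ratio_le_exclusive\<close>). The outcome,
  \<open>failure_probability_le\<close>, bounds the probability of failure by \<open>12 / (sqrt (log 2 n) - 1)\<close>
  as soon as \<open>m \<ge> 2000 n ln n\<close>; in the second part of the theorem \<open>\<omega>\<close> eventually exceeds
  \<open>2000\<close>, so that the same bound applies.
\<close>

section \<open>Random subsets of a finite set\<close>

text \<open>
  The expectation of \<open>f W\<close>, where \<open>W\<close> contains each element of \<open>X\<close> independently with
  probability \<open>p\<close>. A plain finite sum is convenient because everything below is proved by adding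
  one element at a time, or by comparing the weights of two sets.
\<close>

definition binomial_exp :: "real \<Rightarrow> 'a set \<Rightarrow> ('a set \<Rightarrow> real) \<Rightarrow> real" where
  "binomial_exp p X f = (\<Sum>W\<in>Pow X. p ^ card W * (1 - p) ^ card (X - W) * f W)"

lemma binomial_exp_empty [simp]: "binomial_exp p {} f = f {}"
  by (simp add: binomial_exp_def)

lemma binomial_exp_insert:
  assumes "finite X" "x \<notin> X"
  shows "binomial_exp p (insert x X) f = p * binomial_exp p X (\<lambda>W. f (insert x W)) + (1 - p) * binomial_exp p X f"
proof -
  have inj: "inj_on (insert x) (Pow X)"
    using assms by (auto simp: inj_on_def)
  have disj: "Pow X \<inter> insert x ` Pow X = {}"
    using assms by auto
  have "binomial_exp p (insert x X) f
      = (\<Sum>W\<in>Pow X. p ^ card W * (1 - p) ^ card (insert x X - W) * f W)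
      + (\<Sum>W\<in>insert x ` Pow X. p ^ card W * (1 - p) ^ card (insert x X - W) * f W)"
    unfolding binomial_exp_def Pow_insert using assms disj by (subst sum.union_disjoint) auto
  also have "(\<Sum>W\<in>Pow X. p ^ card W * (1 - p) ^ card (insert x X - W) * f W) = (1 - p) * binomial_exp p X f"
    unfolding binomial_exp_def sum_distrib_left
  proof (rule sum.cong[OF refl])
    fix W assume W: "W \<in> Pow X"
    then have "insert x X - W = insert x (X - W)" using assms by auto
    then show "p ^ card W * (1 - p) ^ card (insert x X - W) * f W
        = (1 - p) * (p ^ card W * (1 - p) ^ card (X - W) * f W)"
      using assms by simp
  qed
  also have "(\<Sum>W\<in>insert x ` Pow X. p ^ card W * (1 - p) ^ card (insert x X - W) * f W)
      = p * binomial_exp p X (\<lambda>W. f (insert x W))"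
    unfolding binomial_exp_def sum_distrib_left sum.reindex[OF inj]
  proof (rule sum.cong[OF refl])
    fix W assume W: "W \<in> Pow X"
    then have "insert x X - insert x W = X - W" "card (insert x W) = Suc (card W)"
      using assms by (auto dest: finite_subset intro!: card_insert_disjoint)
    then show "((\<lambda>W. p ^ card W * (1 - p) ^ card (insert x X - W) * f W) \<circ> insert x) W
        = p * (p ^ card W * (1 - p) ^ card (X - W) * f (insert x W))"
      by simp
  qed
  finally show ?thesis by simp
qed

lemma binomial_exp_mono:
  assumes "0 \<le> p" "p \<le> 1" "\<And>W. W \<subseteq> X \<Longrightarrow> f W \<le> g W"
  shows "binomial_exp p X f \<le> binomial_exp p X g"
  unfolding binomial_exp_def using assms by (intro sum_mono mult_left_mono) auto

lemma binomial_exp_add: "binomial_exp p X (\<lambda>W. f W + g W) = binomial_exp p X f + binomial_exp p X g"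
  by (simp add: binomial_exp_def sum.distrib algebra_simps)

lemma binomial_exp_cmult: "binomial_exp p X (\<lambda>W. c * f W) = c * binomial_exp p X f"
  by (simp add: binomial_exp_def sum_distrib_left algebra_simps)

lemma binomial_exp_sum: "binomial_exp p X (\<lambda>W. \<Sum>i\<in>I. f i W) = (\<Sum>i\<in>I. binomial_exp p X (f i))"
  unfolding binomial_exp_def by (simp add: sum_distrib_left) (rule sum.swap)

lemma binomial_exp_const [simp]:
  assumes "finite X" shows "binomial_exp p X (\<lambda>W. c) = c"
  using assms by (induction X) (auto simp: binomial_exp_insert algebra_simps)

text \<open>
  The union of two independent random sets is again a random set of the same kind, which is what
  allows a random set to be revealed in rounds.
\<close>

lemma binomial_exp_two_rounds:
  assumes "finite X"
  shows "binomial_exp p X (\<lambda>A. binomial_exp q X (\<lambda>B. f (A \<union> B))) = binomial_exp (1 - (1 - p) * (1 - q)) X f"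
  using assms
proof (induction X arbitrary: f)
  case empty
  then show ?case by simp
next
  case (insert x X)
  let ?r = "1 - (1 - p) * (1 - q)"
  have 1: "binomial_exp q (insert x X) (\<lambda>B. f (insert x A \<union> B)) = binomial_exp q X (\<lambda>B. f (insert x (A \<union> B)))" for A
    using insert.hyps by (simp add: binomial_exp_insert algebra_simps)
  have 2: "binomial_exp q (insert x X) (\<lambda>B. f (A \<union> B))
      = q * binomial_exp q X (\<lambda>B. f (insert x (A \<union> B))) + (1 - q) * binomial_exp q X (\<lambda>B. f (A \<union> B))" for A
    using insert.hyps by (simp add: binomial_exp_insert)
  note IH1 = insert.IH[of "\<lambda>W. f (insert x W)"]
  have "binomial_exp p (insert x X) (\<lambda>A. binomial_exp q (insert x X) (\<lambda>B. f (A \<union> B)))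
      = p * binomial_exp ?r X (\<lambda>W. f (insert x W)) + (1 - p) * (q * binomial_exp ?r X (\<lambda>W. f (insert x W))
          + (1 - q) * binomial_exp ?r X f)"
    by (subst binomial_exp_insert[OF insert.hyps])
      (simp only: 1 2 binomial_exp_add binomial_exp_cmult insert.IH IH1)
  also have "\<dots> = binomial_exp ?r (insert x X) f"
    by (simp add: binomial_exp_insert insert.hyps algebra_simps)
  finally show ?case .
qed

lemma binomial_exp_disjoint_Un:
  assumes "finite X" "finite Y" "X \<inter> Y = {}"
  shows "binomial_exp p (X \<union> Y) f = binomial_exp p Y (\<lambda>B. binomial_exp p X (\<lambda>A. f (A \<union> B)))"
  using assms
proof (induction X arbitrary: f)
  case empty
  then show ?case by simp
next
  case (insert x X)
  then have x: "x \<notin> X \<union> Y" "finite (X \<union> Y)" "X \<inter> Y = {}" by auto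
  show ?case
    using x insert.hyps insert.prems
    by (simp add: binomial_exp_insert insert.IH binomial_exp_add binomial_exp_cmult)
qed

lemma binomial_exp_avoid:
  assumes "finite X" "A \<subseteq> X"
  shows "binomial_exp p X (\<lambda>W. of_bool (W \<inter> A = {})) = (1 - p) ^ card A"
  using assms
proof (induction X arbitrary: A)
  case empty
  then show ?case by simp
next
  case (insert x X)
  show ?case
  proof (cases "x \<in> A")
    case True
    then have "A = insert x (A - {x})" by auto
    moreover have "finite (A - {x})" using insert finite_subset by blast
    ultimately have c: "card A = Suc (card (A - {x}))"
      by (metis Diff_iff card_insert_disjoint insertI1)
    have "binomial_exp p X (\<lambda>W. of_bool (W \<inter> A = {})) = binomial_exp p X (\<lambda>W. of_bool (W \<inter> (A - {x}) = {}))"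
      unfolding binomial_exp_def using insert.hyps by (intro sum.cong refl) (auto simp: of_bool_def)
    also have "\<dots> = (1 - p) ^ card (A - {x})"
      using insert.prems by (intro insert.IH) auto
    finally show ?thesis unfolding c using True insert.hyps by (simp add: binomial_exp_insert)
  next
    case False
    then have "A \<subseteq> X" using insert.prems by auto
    with False insert.hyps insert.IH[of A] show ?thesis
      by (simp add: binomial_exp_insert algebra_simps)
  qed
qed

section \<open>One colour per edge versus independent colours\<close>

text \<open>
  Partial colourings of \<open>E\<close>, represented by their graphs.
\<close>

definition colourings :: "'e set \<Rightarrow> 'c set \<Rightarrow> ('e \<times> 'c) set set" where
  "colourings E C = {W. W \<subseteq> E \<times> C \<and> inj_on fst W}"

text \<open>
  The expectation of \<open>f W\<close> when every \<open>e \<in> E\<close> independently receives each colour \<open>c \<in> C\<close> with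
  probability \<open>q\<close>, these events being mutually exclusive, and stays uncoloured with probability
  \<open>1 - q * card C\<close>.
\<close>

definition exclusive_exp :: "real \<Rightarrow> 'c set \<Rightarrow> 'e set \<Rightarrow> (('e \<times> 'c) set \<Rightarrow> real) \<Rightarrow> real" where
  "exclusive_exp q C E f = (\<Sum>W\<in>colourings E C. q ^ card W * (1 - q * card C) ^ (card E - card W) * f W)"

lemma finite_colourings: "finite E \<Longrightarrow> finite C \<Longrightarrow> finite (colourings E C)"
  unfolding colourings_def by (rule finite_subset[of _ "Pow (E \<times> C)"]) auto

lemma card_colourings_le:
  assumes "finite E" "W \<in> colourings E C"
  shows "card W \<le> card E"
proof -
  have "card W = card (fst ` W)" using assms by (simp add: colourings_def card_image)
  also have "\<dots> \<le> card E" using assms by (intro card_mono) (auto simp: colourings_def)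
  finally show ?thesis .
qed

lemma colourings_insert:
  assumes "e \<notin> E"
  shows "colourings (insert e E) C =
    colourings E C \<union> (\<Union>c\<in>C. insert (e, c) ` colourings E C)"
proof (intro equalityI subsetI)
  fix W assume W: "W \<in> colourings (insert e E) C"
  show "W \<in> colourings E C \<union> (\<Union>c\<in>C. insert (e, c) ` colourings E C)"
  proof (cases "\<exists>c. (e, c) \<in> W")
    case True
    then obtain c where c: "(e, c) \<in> W" by auto
    have "y \<in> E \<times> C" if y: "y \<in> W - {(e, c)}" for y
    proof -
      have "fst y \<noteq> fst (e, c)"
        using W c y unfolding colourings_def by (metis (no_types, lifting) DiffE inj_onD insertCI mem_Collect_eq)
      moreover have "y \<in> insert e E \<times> C" using W y by (auto simp: colourings_def)
      ultimately show ?thesis by auto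
    qed
    then have "W - {(e, c)} \<in> colourings E C" "c \<in> C"
      using W c by (auto simp: colourings_def intro: inj_on_subset)
    moreover have "W = insert (e, c) (W - {(e, c)})" using c by auto
    ultimately show ?thesis by blast
  next
    case False
    then show ?thesis using W by (auto simp: colourings_def)
  qed
next
  fix W assume "W \<in> colourings E C \<union> (\<Union>c\<in>C. insert (e, c) ` colourings E C)"
  then show "W \<in> colourings (insert e E) C"
    using assms by (auto simp: colourings_def inj_on_def)
qed

lemma exclusive_exp_insert:
  assumes "finite E" "finite C" "e \<notin> E"
  shows "exclusive_exp q C (insert e E) f
    = (1 - q * card C) * exclusive_exp q C E f + q * (\<Sum>c\<in>C. exclusive_exp q C E (\<lambda>W. f (insert (e, c) W)))"
proof -
  let ?w = "\<lambda>W. q ^ card W * (1 - q * card C) ^ (card (insert e E) - card W) * f W"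
  have fin: "finite (colourings E C)" using assms by (simp add: finite_colourings)
  have notin: "(e, c) \<notin> W" if "W \<in> colourings E C" for c W
    using that assms by (auto simp: colourings_def)
  have finW: "finite W" if "W \<in> colourings E C" for W
    using that assms by (auto simp: colourings_def intro: finite_subset)
  have "exclusive_exp q C (insert e E) f = sum ?w (colourings E C) + sum ?w (\<Union>c\<in>C. insert (e, c) ` colourings E C)"
    unfolding exclusive_exp_def colourings_insert[OF assms(3)]
    using fin assms notin by (subst sum.union_disjoint) auto
  also have "sum ?w (colourings E C) = (1 - q * card C) * exclusive_exp q C E f"
    unfolding exclusive_exp_def sum_distrib_left
    using assms by (intro sum.cong refl)
      (simp add: card_colourings_le Suc_diff_le)
  also have "sum ?w (\<Union>c\<in>C. insert (e, c) ` colourings E C)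
      = (\<Sum>c\<in>C. sum ?w (insert (e, c) ` colourings E C))"
  proof (rule sum.UNION_disjoint)
    show "\<forall>i\<in>C. \<forall>j\<in>C. i \<noteq> j \<longrightarrow>
        insert (e, i) ` colourings E C \<inter> insert (e, j) ` colourings E C = {}"
      using notin by blast
  qed (use fin assms in auto)
  also have "\<dots> = (\<Sum>c\<in>C. q * exclusive_exp q C E (\<lambda>W. f (insert (e, c) W)))"
  proof (rule sum.cong[OF refl])
    fix c assume "c \<in> C"
    have inj: "inj_on (insert (e, c)) (colourings E C)"
      using notin by (intro inj_onI) (metis insert_ident)
    show "sum ?w (insert (e, c) ` colourings E C) = q * exclusive_exp q C E (\<lambda>W. f (insert (e, c) W))"
      unfolding exclusive_exp_def sum_distrib_left sum.reindex[OF inj]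
      using assms notin finW by (intro sum.cong refl) simp
  qed
  finally show ?thesis by (simp add: sum_distrib_left)
qed

lemma exclusive_exp_mono:
  fixes q :: real
  assumes "0 \<le> q" "q * card C \<le> 1" "\<And>W. W \<in> colourings E C \<Longrightarrow> f W \<le> g W"
  shows "exclusive_exp q C E f \<le> exclusive_exp q C E g"
  unfolding exclusive_exp_def using assms by (intro sum_mono mult_left_mono) auto

lemma binomial_exclusive_swap:
  "binomial_exp p X (\<lambda>B. exclusive_exp q C E (\<lambda>W. f B W)) = exclusive_exp q C E (\<lambda>W. binomial_exp p X (\<lambda>B. f B W))"
  unfolding binomial_exp_def exclusive_exp_def sum_distrib_left
  by (subst sum.swap) (simp add: algebra_simps)

lemma exclusive_exp_add: "exclusive_exp q C E (\<lambda>W. f W + g W) = exclusive_exp q C E f + exclusive_exp q C E g"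
  by (simp add: exclusive_exp_def sum.distrib algebra_simps)

lemma exclusive_exp_cmult: "exclusive_exp q C E (\<lambda>W. c * f W) = c * exclusive_exp q C E f"
  by (simp add: exclusive_exp_def sum_distrib_left algebra_simps)

lemma exclusive_exp_sum: "exclusive_exp q C E (\<lambda>W. \<Sum>i\<in>I. f i W) = (\<Sum>i\<in>I. exclusive_exp q C E (f i))"
  unfolding exclusive_exp_def by (simp add: sum_distrib_left) (rule sum.swap)

definition misses :: "'a set set \<Rightarrow> 'a set \<Rightarrow> real" where
  "misses H W = of_bool (\<forall>S\<in>H. \<not> S \<subseteq> W)"

text \<open>
  The whole comparison happens at a single edge \<open>e\<close>. Fix the rest \<open>W\<close>. If \<open>W\<close> alone
  contains no member of \<open>H\<close>, then success depends only on whether \<open>e\<close> gets a colour from a certain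
  set \<open>A\<close>, because no member uses two colours of \<open>e\<close>. With exclusive colours this has probability
  exactly \<open>q * card A\<close>, which is the union bound for independent colours.
\<close>

lemma one_edge_exclusive_le_independent:
  fixes q :: real
  assumes "finite C" "0 \<le> q" "q \<le> 1"
    and H: "\<And>S. S \<in> H \<Longrightarrow> inj_on fst S"
  shows "(1 - q * card C) * misses H W + q * (\<Sum>c\<in>C. misses H (insert (e, c) W))
      \<le> binomial_exp q ({e} \<times> C) (\<lambda>B. misses H (W \<union> B))"
proof (cases "\<exists>S\<in>H. S \<subseteq> W")
  case True
  then have "misses H W = 0" "\<And>B. misses H (W \<union> B) = 0" "\<And>c. misses H (insert (e, c) W) = 0"
    by (auto simp: misses_def)
  then show ?thesis using assms by simp
next
  case False
  define A where "A = {c \<in> C. \<exists>S\<in>H. S \<subseteq> insert (e, c) W}"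
  have A: "A \<subseteq> C" "finite A" using assms(1) by (auto simp: A_def)
  have single: "misses H (W \<union> B) = of_bool (B \<inter> ({e} \<times> A) = {})" if B: "B \<subseteq> {e} \<times> C" for B
  proof -
    have "(\<exists>S\<in>H. S \<subseteq> W \<union> B) \<longleftrightarrow> B \<inter> ({e} \<times> A) \<noteq> {}"
    proof
      assume "\<exists>S\<in>H. S \<subseteq> W \<union> B"
      then obtain S where S: "S \<in> H" "S \<subseteq> W \<union> B" by auto
      then obtain x where x: "x \<in> S" "x \<notin> W" using False by blast
      then obtain c where c: "x = (e, c)" "c \<in> C" "x \<in> B" using S B by auto
      have "S \<subseteq> insert (e, c) W"
      proof
        fix y assume y: "y \<in> S"
        show "y \<in> insert (e, c) W"
        proof (cases "y \<in> W")
          case False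
          then have "fst y = e" using y S B by auto
          then have "y = x" using H[OF S(1)] x y c by (auto simp: inj_on_def)
          then show ?thesis using c by simp
        qed simp
      qed
      then have "c \<in> A" using c S by (auto simp: A_def)
      then show "B \<inter> ({e} \<times> A) \<noteq> {}" using c by auto
    next
      assume "B \<inter> ({e} \<times> A) \<noteq> {}"
      then obtain c where c: "(e, c) \<in> B" "c \<in> A" by auto
      then obtain S where S: "S \<in> H" "S \<subseteq> insert (e, c) W" by (auto simp: A_def)
      then have "S \<subseteq> W \<union> B" using c by auto
      then show "\<exists>S\<in>H. S \<subseteq> W \<union> B" using S by auto
    qed
    then show ?thesis by (auto simp: misses_def)
  qed
  have "(\<Sum>c\<in>C. misses H (insert (e, c) W)) = (\<Sum>c\<in>C. of_bool (c \<notin> A))"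
    by (intro sum.cong refl) (auto simp: A_def misses_def)
  also have "\<dots> = real (card (C - A))"
    using assms(1) by (simp add: sum.If_cases of_bool_def Diff_eq Int_def Collect_neg_eq)
  also have "\<dots> = real (card C) - real (card A)"
    using A assms(1) by (simp add: card_Diff_subset card_mono of_nat_diff)
  finally have count: "(\<Sum>c\<in>C. misses H (insert (e, c) W)) = real (card C) - real (card A)" .
  have "misses H W = 1" using False by (auto simp: misses_def)
  then have "(1 - q * card C) * misses H W + q * (\<Sum>c\<in>C. misses H (insert (e, c) W))
      = 1 + real (card A) * (- q)"
    unfolding count by (simp add: algebra_simps)
  also have "\<dots> \<le> (1 + (- q)) ^ card A"
    using assms by (intro Bernoulli_inequality) auto
  also have "\<dots> = binomial_exp q ({e} \<times> C) (\<lambda>B. of_bool (B \<inter> ({e} \<times> A) = {}))"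
    using A assms(1) by (subst binomial_exp_avoid) (auto simp: card_cartesian_product)
  also have "\<dots> = binomial_exp q ({e} \<times> C) (\<lambda>B. misses H (W \<union> B))"
    unfolding binomial_exp_def using single by (intro sum.cong refl) simp
  finally show ?thesis .
qed

text \<open>
  Induction on the edges: conditioning on the colours \<open>B\<close> of one edge turns \<open>H\<close> into the family
  of the sets \<open>S - B\<close>, to which the induction hypothesis applies, and then that edge itself is
  exchanged.
\<close>

lemma exclusive_le_independent:
  fixes q :: real
  assumes "finite E" "finite C" "0 \<le> q" "q * card C \<le> 1" "q \<le> 1"
    and "\<And>S. S \<in> H \<Longrightarrow> inj_on fst S"
  shows "exclusive_exp q C E (misses H) \<le> binomial_exp q (E \<times> C) (misses H)"
  using assms(1,6)
proof (induction E arbitrary: H)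
  case empty
  have "(colourings {} C :: ('a \<times> 'b) set set) = {{}}" by (auto simp: colourings_def)
  then show ?case by (simp add: exclusive_exp_def)
next
  case (insert e E)
  have shift: "misses ((\<lambda>S. S - B) ` H) = (\<lambda>W. misses H (W \<union> B))" for B
    by (rule ext) (auto simp: misses_def)
  have "exclusive_exp q C (insert e E) (misses H)
      = exclusive_exp q C E (\<lambda>W. (1 - q * card C) * misses H W + q * (\<Sum>c\<in>C. misses H (insert (e, c) W)))"
    using insert.hyps assms(2) by (simp add: exclusive_exp_insert exclusive_exp_add exclusive_exp_cmult exclusive_exp_sum)
  also have "\<dots> \<le> exclusive_exp q C E (\<lambda>W. binomial_exp q ({e} \<times> C) (\<lambda>B. misses H (W \<union> B)))"
    using assms insert.prems
    by (intro exclusive_exp_mono one_edge_exclusive_le_independent) auto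
  also have "\<dots> = binomial_exp q ({e} \<times> C) (\<lambda>B. exclusive_exp q C E (misses ((\<lambda>S. S - B) ` H)))"
    by (simp add: binomial_exclusive_swap shift)
  also have "\<dots> \<le> binomial_exp q ({e} \<times> C) (\<lambda>B. binomial_exp q (E \<times> C) (misses ((\<lambda>S. S - B) ` H)))"
    using assms insert.prems by (intro binomial_exp_mono insert.IH) (auto intro: inj_on_subset)
  also have "\<dots> = binomial_exp q (E \<times> C \<union> {e} \<times> C) (misses H)"
    using insert.hyps assms(2) by (subst binomial_exp_disjoint_Un) (auto simp: shift)
  also have "E \<times> C \<union> {e} \<times> C = insert e E \<times> C" by auto
  finally show ?case .
qed

section \<open>Spread families and minimal fragments\<close>

text \<open>
  Among the members of the family inside \<open>W \<union> B j\<close>, take one with the fewest elements outside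
  \<open>W\<close>; its part outside \<open>W\<close> is the fragment. For \<open>j \<in> J\<close> it lies in \<open>B j\<close>, and completing it within a later
  random set completes a member of the family.
\<close>

definition fragment :: "('i \<Rightarrow> 'a set) \<Rightarrow> 'i set \<Rightarrow> 'a set \<Rightarrow> 'i \<Rightarrow> 'a set" where
  "fragment B J W j = B (arg_min (\<lambda>i. card (B i - W)) (\<lambda>i. i \<in> J \<and> B i \<subseteq> W \<union> B j)) - W"

lemma fragment_witness:
  assumes "j \<in> J"
  shows "\<exists>i\<in>J. B i \<subseteq> W \<union> B j \<and> fragment B J W j = B i - W"
  using arg_min_natI[of "\<lambda>i. i \<in> J \<and> B i \<subseteq> W \<union> B j" j "\<lambda>i. card (B i - W)"] assms
  unfolding fragment_def by auto

lemma fragment_minimal: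
  assumes "i \<in> J" "B i \<subseteq> W \<union> B j"
  shows "card (fragment B J W j) \<le> card (B i - W)"
  using arg_min_nat_le[of "\<lambda>i. i \<in> J \<and> B i \<subseteq> W \<union> B j" i "\<lambda>i. card (B i - W)"] assms
  unfolding fragment_def by auto

lemma fragment_subset:
  assumes "j \<in> J"
  shows "fragment B J W j \<subseteq> B j" "fragment B J W j \<inter> W = {}"
proof -
  obtain i where "B i \<subseteq> W \<union> B j" "fragment B J W j = B i - W"
    using fragment_witness[OF assms] by metis
  then show "fragment B J W j \<subseteq> B j" "fragment B J W j \<inter> W = {}" by blast+
qed

text \<open>
  The normalisation \<open>M\<close> is independent of \<open>J\<close>, so that the condition survives when members are
  discarded or made smaller. In applications \<open>M\<close> is the cardinality of the original family.
\<close>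

definition spread :: "real \<Rightarrow> real \<Rightarrow> 'i set \<Rightarrow> ('i \<Rightarrow> 'a set) \<Rightarrow> bool" where
  "spread \<kappa> M J B \<longleftrightarrow> (\<forall>T. finite T \<longrightarrow> real (card {j \<in> J. T \<subseteq> B j}) \<le> M / \<kappa> ^ card T)"

lemma spread_subfamily:
  assumes "spread \<kappa> M J B" "J' \<subseteq> J" "finite J" "\<And>j. j \<in> J' \<Longrightarrow> B' j \<subseteq> B j"
  shows "spread \<kappa> M J' B'"
  unfolding spread_def
proof (intro allI impI)
  fix T :: "'b set" assume "finite T"
  have "card {j \<in> J'. T \<subseteq> B' j} \<le> card {j \<in> J. T \<subseteq> B j}"
    using assms by (intro card_mono) auto
  also have "real \<dots> \<le> M / \<kappa> ^ card T"
    using assms(1) \<open>finite T\<close> by (auto simp: spread_def)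
  finally show "real (card {j \<in> J'. T \<subseteq> B' j}) \<le> M / \<kappa> ^ card T" by simp
qed

text \<open>
  The key observation of Park and Pham. If \<open>T\<close> is a fragment left by \<open>Z - T\<close>, then every member
  inside \<open>Z\<close> competes in the choice of the fragment, so by minimality it cannot have fewer than
  \<open>card T\<close> elements outside \<open>Z - T\<close>; but these all lie in \<open>T\<close>.
\<close>

lemma fragment_subset_of_any:
  assumes "finite Z" "T \<subseteq> Z" "j \<in> J" "fragment B J (Z - T) j = T"
    and "i \<in> J" "B i \<subseteq> Z"
  shows "T \<subseteq> B i"
proof -
  let ?W = "Z - T"
  have "T \<subseteq> B j" using fragment_subset(1)[OF assms(3), of B ?W] assms(4) by simp
  then have "B i \<subseteq> ?W \<union> B j" using assms by auto
  then have "card T \<le> card (B i - ?W)"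
    using fragment_minimal[of i J B ?W j] assms by simp
  moreover have "B i - ?W \<subseteq> T" "finite T" using assms finite_subset by auto
  ultimately have "B i - ?W = T" by (simp add: card_seteq)
  then show ?thesis by auto
qed

text \<open>
  One member \<open>B i \<subseteq> Z\<close>, chosen arbitrarily, contains all the fragments compatible with \<open>Z\<close>. So there
  are few of them, although they come from many different sets \<open>W\<close>.
\<close>

lemma fragment_candidates:
  assumes "finite Z" and l: "\<And>j. j \<in> J \<Longrightarrow> finite (B j) \<and> card (B j) \<le> l"
  shows "card {T. T \<subseteq> Z \<and> card T = t \<and> (\<exists>j\<in>J. fragment B J (Z - T) j = T)} \<le> l choose t"
    (is "card ?U \<le> _")
proof (cases "?U = {}")
  case True
  then show ?thesis by (metis card.empty le0)
next
  case False
  then obtain T j where T: "T \<subseteq> Z" "j \<in> J" "fragment B J (Z - T) j = T" by auto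
  obtain i where i: "i \<in> J" "B i \<subseteq> (Z - T) \<union> B j" "fragment B J (Z - T) j = B i - (Z - T)"
    using fragment_witness[OF T(2)] by metis
  have "B i \<subseteq> Z" using i T by auto
  then have "?U \<subseteq> {T. T \<subseteq> B i \<and> card T = t}"
    using fragment_subset_of_any[OF assms(1) _ _ _ i(1)] by blast
  moreover have "finite {T. T \<subseteq> B i \<and> card T = t}" using l[OF i(1)] by simp
  ultimately have "card ?U \<le> card {T. T \<subseteq> B i \<and> card T = t}" by (rule card_mono[rotated])
  also have "\<dots> = card (B i) choose t" using l[OF i(1)] by (simp add: n_subsets)
  also have "\<dots> \<le> l choose t" using l[OF i(1)] by (simp add: binomial_right_mono)
  finally show ?thesis .
qed

text \<open>
  Count pairs of a set \<open>W\<close> and a fragment \<open>T\<close> of size \<open>t\<close> through \<open>Z = W \<union> T\<close>. Adding \<open>T\<close> to \<open>W\<close>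
  multiplies the weight by at least \<open>p ^ t\<close>, a given \<open>Z\<close> admits at most \<open>l choose t\<close> fragments, and
  a given \<open>T\<close> is the fragment of at most \<open>M / \<kappa> ^ t\<close> indices because it is a subset of each of their
  sets.
\<close>

lemma expected_fragments:
  assumes X: "finite X" and J: "finite J"
    and B: "\<And>j. j \<in> J \<Longrightarrow> B j \<subseteq> X \<and> card (B j) \<le> l"
    and sp: "spread \<kappa> M J B" and p: "0 < p" "p \<le> 1" and \<kappa>: "0 < \<kappa>" and M: "0 \<le> M"
  shows "binomial_exp p X (\<lambda>W. card {j \<in> J. card (fragment B J W j) = t})
    \<le> M * (l choose t) / (p * \<kappa>) ^ t"
proof -
  let ?\<mu> = "\<lambda>W. p ^ card W * (1 - p) ^ card (X - W)"
  define TT where "TT W = {T \<in> fragment B J W ` J. card T = t}" for W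
  define UU where "UU Z = {T. T \<subseteq> Z \<and> card T = t \<and> (\<exists>j\<in>J. fragment B J (Z - T) j = T)}" for Z
  have finB: "finite (B j)" if "j \<in> J" for j using B[OF that] X finite_subset by auto
  have finTT: "finite (TT W)" for W using J by (simp add: TT_def)
  have finUU: "finite (UU Z)" if "Z \<subseteq> X" for Z
    using finite_subset[OF that X] by (auto simp: UU_def)
  have TTX: "T \<subseteq> X" "T \<inter> W = {}" "finite T" "card T = t" if T: "T \<in> TT W" for T W
  proof -
    obtain j where j: "j \<in> J" "T = fragment B J W j" "card T = t" using T unfolding TT_def by blast
    then show "T \<subseteq> X" "T \<inter> W = {}" "card T = t"
      using fragment_subset[OF j(1), of B W] B[OF j(1)] by auto
    then show "finite T" using X finite_subset by auto
  qed
  \<comment> \<open>an index with fragment \<open>T\<close> has \<open>T\<close> as a subset of its set, so the spread condition counts the indices\<close>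
  have count: "real (card {j \<in> J. card (fragment B J W j) = t}) \<le> (M / \<kappa> ^ t) * card (TT W)" for W
  proof -
    have "card {j \<in> J. card (fragment B J W j) = t} \<le> card (\<Union>T\<in>TT W. {j \<in> J. T \<subseteq> B j})"
      using J finTT fragment_subset(1)[of _ J B W] by (intro card_mono) (auto simp: TT_def)
    also have "\<dots> \<le> (\<Sum>T\<in>TT W. card {j \<in> J. T \<subseteq> B j})"
      by (rule card_UN_le[OF finTT])
    also have "real \<dots> \<le> (\<Sum>T\<in>TT W. M / \<kappa> ^ t)"
      unfolding of_nat_sum
    proof (rule sum_mono)
      fix T assume "T \<in> TT W"
      then show "real (card {j \<in> J. T \<subseteq> B j}) \<le> M / \<kappa> ^ t"
        using sp TTX(3,4)[of T W] unfolding spread_def by blast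
    qed
    finally show ?thesis by (simp add: mult.commute)
  qed
  \<comment> \<open>exchange the pairs \<open>(W, T)\<close> for the pairs \<open>(W \<union> T, T)\<close>\<close>
  have "p ^ t * (\<Sum>W\<in>Pow X. ?\<mu> W * card (TT W)) = (\<Sum>(W, T)\<in>Sigma (Pow X) TT. p ^ t * ?\<mu> W)"
    using X finTT by (subst sum.Sigma[symmetric]) (auto simp: sum_distrib_left algebra_simps)
  also have "\<dots> \<le> (\<Sum>(Z, T)\<in>Sigma (Pow X) UU. ?\<mu> Z)"
  proof (rule sum_le_included[where i = "\<lambda>(Z, T). (Z - T, T)"])
    show "\<forall>x\<in>Sigma (Pow X) TT. \<exists>y\<in>Sigma (Pow X) UU. (case y of (Z, T) \<Rightarrow> (Z - T, T)) = x \<and>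
        (case x of (W, T) \<Rightarrow> p ^ t * ?\<mu> W) \<le> (case y of (Z, T) \<Rightarrow> ?\<mu> Z)"
    proof clarify
      fix W T assume W: "W \<subseteq> X" and T: "T \<in> TT W"
      note T' = TTX[OF T]
      have e: "W \<union> T - T = W" using T' by auto
      obtain j where j: "j \<in> J" "fragment B J W j = T" using T by (auto simp: TT_def)
      have "T \<in> UU (W \<union> T)" using j e T' by (auto simp: UU_def)
      moreover have "p ^ t * ?\<mu> W \<le> ?\<mu> (W \<union> T)"
      proof -
        have c: "card (W \<union> T) = t + card W"
          using T' W X finite_subset by (subst card_Un_disjoint) auto
        have "card (X - (W \<union> T)) \<le> card (X - W)" using X by (intro card_mono) auto
        then have "(1 - p) ^ card (X - W) \<le> (1 - p) ^ card (X - (W \<union> T))"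
          using p by (intro power_decreasing) auto
        then show ?thesis using p unfolding c power_add
          by (simp add: mult_left_mono)
      qed
      ultimately show "\<exists>y\<in>Sigma (Pow X) UU. (case y of (Z, T) \<Rightarrow> (Z - T, T)) = (W, T) \<and>
          p ^ t * ?\<mu> W \<le> (case y of (Z, T) \<Rightarrow> ?\<mu> Z)"
        using e W T' by (intro bexI[of _ "(W \<union> T, T)"]) auto
    qed
  qed (use X finTT finUU p in auto)
  also have "\<dots> = (\<Sum>Z\<in>Pow X. ?\<mu> Z * card (UU Z))"
    using X finUU by (subst sum.Sigma[symmetric]) (auto simp: algebra_simps)
  also have "\<dots> \<le> (\<Sum>Z\<in>Pow X. ?\<mu> Z * (l choose t))"
  proof (intro sum_mono mult_left_mono)
    fix Z assume "Z \<in> Pow X"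
    then have "finite Z" using X finite_subset by auto
    then have "card (UU Z) \<le> l choose t"
      unfolding UU_def using B finB by (intro fragment_candidates) auto
    then show "real (card (UU Z)) \<le> real (l choose t)" by simp
  qed (use p in auto)
  also have "\<dots> = l choose t"
    using binomial_exp_const[OF X, of p "real (l choose t)"] by (simp add: binomial_exp_def)
  finally have main: "p ^ t * (\<Sum>W\<in>Pow X. ?\<mu> W * card (TT W)) \<le> l choose t" .
  have "binomial_exp p X (\<lambda>W. card {j \<in> J. card (fragment B J W j) = t})
      \<le> binomial_exp p X (\<lambda>W. (M / \<kappa> ^ t) * card (TT W))"
    using p count by (intro binomial_exp_mono) auto
  also have "\<dots> = (M / \<kappa> ^ t) * (\<Sum>W\<in>Pow X. ?\<mu> W * card (TT W))"
    unfolding binomial_exp_cmult by (simp only: binomial_exp_def)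
  also have "\<dots> \<le> (M / \<kappa> ^ t) * ((l choose t) / p ^ t)"
    using main p M \<kappa> by (intro mult_left_mono) (auto simp: field_simps)
  finally show ?thesis by (simp add: field_simps)
qed

lemma expected_fragments_in:
  assumes "finite X" "finite J"
    and "\<And>j. j \<in> J \<Longrightarrow> B j \<subseteq> X \<and> card (B j) \<le> l"
    and "spread \<kappa> M J B" "0 < p" "p \<le> 1" "0 < \<kappa>" "0 \<le> M" "finite R"
  shows "binomial_exp p X (\<lambda>W. card {j \<in> J. card (fragment B J W j) \<in> R})
    \<le> M * (\<Sum>t\<in>R. (l choose t) / (p * \<kappa>) ^ t)"
proof -
  have "card {j \<in> J. card (fragment B J W j) \<in> R} = (\<Sum>t\<in>R. card {j \<in> J. card (fragment B J W j) = t})" for W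
  proof -
    have "{j \<in> J. card (fragment B J W j) \<in> R} = (\<Union>t\<in>R. {j \<in> J. card (fragment B J W j) = t})" by auto
    moreover have "card (\<Union>t\<in>R. {j \<in> J. card (fragment B J W j) = t})
        = (\<Sum>t\<in>R. card {j \<in> J. card (fragment B J W j) = t})"
      using assms(2,9) by (intro card_UN_disjoint) auto
    ultimately show ?thesis by simp
  qed
  then have "binomial_exp p X (\<lambda>W. card {j \<in> J. card (fragment B J W j) \<in> R})
      = (\<Sum>t\<in>R. binomial_exp p X (\<lambda>W. card {j \<in> J. card (fragment B J W j) = t}))"
    by (simp add: binomial_exp_sum)
  also have "\<dots> \<le> (\<Sum>t\<in>R. M * (l choose t) / (p * \<kappa>) ^ t)"
    using assms by (intro sum_mono expected_fragments) auto
  finally show ?thesis by (simp add: sum_distrib_left)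
qed

text \<open>
  The bound on the probability that a random set of density \<open>p\<close> contains no member, required for
  all spread families of sets of size at most \<open>l\<close> indexed by some \<open>J \<subseteq> I\<close>. The term
  \<open>1 - card J / card I\<close> pays for the indices that were discarded in earlier rounds, which is what
  makes the statement suitable for induction over the rounds.
\<close>

definition covered :: "'a set \<Rightarrow> 'i set \<Rightarrow> real \<Rightarrow> real \<Rightarrow> nat \<Rightarrow> real \<Rightarrow> bool" where
  "covered X I \<kappa> p l \<delta> \<longleftrightarrow>
    (\<forall>J B. J \<subseteq> I \<longrightarrow> (\<forall>j\<in>J. B j \<subseteq> X \<and> card (B j) \<le> l) \<longrightarrow> spread \<kappa> (card I) J B \<longrightarrow>
      binomial_exp p X (misses (B ` J)) \<le> \<delta> + (1 - card J / card I))"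

text \<open>
  If no member lies in \<open>W\<close>, then all the fragments are nonempty, and their expected number is
  bounded by the binomial expansion of \<open>(1 + 1 / (p * \<kappa>)) ^ l\<close> without its constant term. This is
  small only if \<open>l\<close> is small compared with \<open>p * \<kappa>\<close>, so it serves as the last round.
\<close>

lemma covered_one_round:
  assumes X: "finite X" and I: "finite I" "I \<noteq> {}" and p: "0 < p" "p \<le> 1" and \<kappa>: "0 < \<kappa>"
  shows "covered X I \<kappa> p l ((1 + 1 / (p * \<kappa>)) ^ l - 1)"
  unfolding covered_def
proof (intro allI impI)
  fix J and B :: "'b \<Rightarrow> 'a set"
  assume J: "J \<subseteq> I" and B: "\<forall>j\<in>J. B j \<subseteq> X \<and> card (B j) \<le> l" and sp: "spread \<kappa> (card I) J B"
  have finJ: "finite J" using J I finite_subset by auto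
  have M: "real (card I) > 0" using I by (simp add: card_gt_0_iff)
  let ?b = "\<lambda>W. card {j \<in> J. card (fragment B J W j) \<in> {1..l}}"
  have pt: "misses (B ` J) W \<le> (1 - card J / card I) + (1 / card I) * ?b W" if "W \<subseteq> X" for W
  proof (cases "\<exists>j\<in>J. B j \<subseteq> W")
    case True
    then have "misses (B ` J) W = 0" by (auto simp: misses_def)
    moreover have "real (card J) \<le> real (card I)" using J I by (simp add: card_mono)
    ultimately show ?thesis using M by simp
  next
    case False
    have "{j \<in> J. card (fragment B J W j) \<in> {1..l}} = J"
    proof (intro equalityI subsetI)
      fix j assume j: "j \<in> J"
      then obtain i where i: "i \<in> J" "fragment B J W j = B i - W" using fragment_witness by metis
      have "finite (B i)" using i B X by (meson finite_subset)
      moreover have "B i - W \<noteq> {}" using i False by auto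
      ultimately have "card (B i - W) \<noteq> 0" by simp
      moreover have "card (B i - W) \<le> card (B i)" using \<open>finite (B i)\<close> by (intro card_mono) auto
      moreover have "card (B i) \<le> l" using B i by auto
      ultimately show "j \<in> {j \<in> J. card (fragment B J W j) \<in> {1..l}}" using i j by auto
    qed auto
    then show ?thesis by (simp add: misses_def)
  qed
  have "binomial_exp p X (misses (B ` J))
      \<le> binomial_exp p X (\<lambda>W. (1 - card J / card I) + (1 / card I) * ?b W)"
    using p pt by (intro binomial_exp_mono) auto
  also have "\<dots> = (1 - card J / card I) + (1 / card I) * binomial_exp p X ?b"
    using X by (simp only: binomial_exp_add binomial_exp_cmult binomial_exp_const)
  also have "binomial_exp p X ?b \<le> card I * (\<Sum>t\<in>{1..l}. (l choose t) / (p * \<kappa>) ^ t)"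
    using X finJ B sp p \<kappa> by (intro expected_fragments_in) auto
  also have "(\<Sum>t\<in>{1..l}. (l choose t) / (p * \<kappa>) ^ t) = (1 + 1 / (p * \<kappa>)) ^ l - 1"
  proof -
    have "(1 / (p * \<kappa>) + 1) ^ l = (\<Sum>t\<le>l. (l choose t) * (1 / (p * \<kappa>)) ^ t * 1 ^ (l - t))"
      by (rule binomial_ring)
    also have "\<dots> = (\<Sum>t\<le>l. (l choose t) / (p * \<kappa>) ^ t)"
      by (simp add: power_one_over field_simps)
    also have "{..l} = insert 0 {1..l}" by auto
    finally show ?thesis by (simp add: add.commute)
  qed
  finally show "binomial_exp p X (misses (B ` J))
      \<le> (1 + 1 / (p * \<kappa>)) ^ l - 1 + (1 - card J / card I)"
    using M by (simp add: divide_simps)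
qed

text \<open>
  With \<open>p * \<kappa> = 16\<close> the expected proportion of fragments larger than \<open>l\<close> is at most
  \<open>2 ^ (2 * l) / 16 ^ l\<close>. Their indices are discarded, and the remaining fragments form a spread
  family of sets of size at most \<open>l\<close>, to which the assumption for \<open>q\<close> applies.
\<close>

lemma covered_halving_round:
  assumes X: "finite X" and I: "finite I" "I \<noteq> {}" and p: "0 < p" "p \<le> 1" and \<kappa>: "0 < \<kappa>"
    and p\<kappa>: "p * \<kappa> = 16" and q: "0 \<le> q" "q \<le> 1" and IH: "covered X I \<kappa> q l \<delta>"
  shows "covered X I \<kappa> (1 - (1 - p) * (1 - q)) (2 * l) (\<delta> + 1 / 4 ^ l)"
  unfolding covered_def
proof (intro allI impI)
  fix J and B :: "'b \<Rightarrow> 'a set"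
  assume J: "J \<subseteq> I" and B: "\<forall>j\<in>J. B j \<subseteq> X \<and> card (B j) \<le> 2 * l"
    and sp: "spread \<kappa> (card I) J B"
  have finJ: "finite J" using J I finite_subset by auto
  have M: "real (card I) > 0" using I by (simp add: card_gt_0_iff)
  let ?b = "\<lambda>W. card {j \<in> J. card (fragment B J W j) \<in> {l<..2*l}}"
  have pt: "binomial_exp q X (\<lambda>W'. misses (B ` J) (W \<union> W'))
      \<le> (\<delta> + (1 - card J / card I)) + (1 / card I) * ?b W" if "W \<subseteq> X" for W
  proof -
    define J' where "J' = {j \<in> J. card (fragment B J W j) \<le> l}"
    have J': "J' \<subseteq> J" by (auto simp: J'_def)
    \<comment> \<open>completing a fragment in the later rounds completes a member\<close>
    have "misses (B ` J) (W \<union> W') \<le> misses (fragment B J W ` J') W'" for W'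
    proof -
      have "\<exists>i\<in>J. B i \<subseteq> W \<union> W'" if "j \<in> J'" "fragment B J W j \<subseteq> W'" for j
      proof -
        obtain i where "i \<in> J" "fragment B J W j = B i - W"
          using fragment_witness[of j J B W] \<open>j \<in> J'\<close> J' by blast
        then show ?thesis using that by auto
      qed
      then show ?thesis by (auto simp: misses_def)
    qed
    then have "binomial_exp q X (\<lambda>W'. misses (B ` J) (W \<union> W'))
        \<le> binomial_exp q X (misses (fragment B J W ` J'))"
      using q by (intro binomial_exp_mono) auto
    also have "\<dots> \<le> \<delta> + (1 - card J' / card I)"
    proof -
      have "spread \<kappa> (card I) J' (fragment B J W)"
        by (rule spread_subfamily[OF sp J' finJ], rule fragment_subset(1)) (use J' in auto)
      moreover have "\<forall>j\<in>J'. fragment B J W j \<subseteq> X \<and> card (fragment B J W j) \<le> l"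
      proof
        fix j assume "j \<in> J'"
        then have "j \<in> J" "card (fragment B J W j) \<le> l" by (auto simp: J'_def)
        then show "fragment B J W j \<subseteq> X \<and> card (fragment B J W j) \<le> l"
          using fragment_subset(1)[of j J B W] B by blast
      qed
      ultimately show ?thesis using IH J J' unfolding covered_def by blast
    qed
    also have "real (card J') = real (card J) - ?b W"
    proof -
      have "J - J' = {j \<in> J. card (fragment B J W j) \<in> {l<..2*l}}"
      proof -
        have "card (fragment B J W j) \<le> 2 * l" if "j \<in> J" for j
        proof -
          have "card (fragment B J W j) \<le> card (B j)"
            using that fragment_subset(1)[of j J B W] B X by (intro card_mono) (meson finite_subset)+
          then show ?thesis using B that by force
        qed
        then show ?thesis by (auto simp: J'_def)
      qed
      moreover have "card (J - J') = card J - card J'" "card J' \<le> card J"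
        using J' finJ finite_subset[OF J' finJ] by (simp_all add: card_mono card_Diff_subset)
      ultimately show ?thesis by simp
    qed
    finally show ?thesis using M by (simp add: diff_divide_distrib)
  qed
  have "binomial_exp (1 - (1 - p) * (1 - q)) X (misses (B ` J))
      = binomial_exp p X (\<lambda>W. binomial_exp q X (\<lambda>W'. misses (B ` J) (W \<union> W')))"
    by (rule binomial_exp_two_rounds[OF X, symmetric])
  also have "\<dots> \<le> binomial_exp p X (\<lambda>W. (\<delta> + (1 - card J / card I)) + (1 / card I) * ?b W)"
    using p pt by (intro binomial_exp_mono) auto
  also have "\<dots> = (\<delta> + (1 - card J / card I)) + (1 / card I) * binomial_exp p X ?b"
    using X by (simp only: binomial_exp_add binomial_exp_cmult binomial_exp_const)
  also have "binomial_exp p X ?b \<le> card I * (\<Sum>t\<in>{l<..2*l}. (2 * l choose t) / (p * \<kappa>) ^ t)"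
    using X finJ B sp p \<kappa> by (intro expected_fragments_in) auto
  also have "(\<Sum>t\<in>{l<..2*l}. (2 * l choose t) / (p * \<kappa>) ^ t) \<le> 1 / 4 ^ l"
  proof -
    have "(\<Sum>t\<in>{l<..2*l}. (2 * l choose t) / (p * \<kappa>) ^ t)
        \<le> (\<Sum>t\<in>{l<..2*l}. (2 * l choose t) / 16 ^ l)"
      unfolding p\<kappa> by (intro sum_mono divide_left_mono) (auto intro: power_increasing)
    also have "\<dots> \<le> (\<Sum>t\<le>2*l. (2 * l choose t) / 16 ^ l)"
      by (intro sum_mono2) auto
    also have "\<dots> = real (\<Sum>t\<le>2*l. 2 * l choose t) / 16 ^ l"
      by (simp add: sum_divide_distrib)
    also have "\<dots> = 4 ^ l / (4 ^ l * 4 ^ l)"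
      unfolding choose_row_sum by (simp add: power_mult power_mult_distrib[symmetric])
    finally show ?thesis by simp
  qed
  finally show "binomial_exp (1 - (1 - p) * (1 - q)) X (misses (B ` J))
      \<le> \<delta> + 1 / 4 ^ l + (1 - card J / card I)"
    using M by (simp add: divide_right_mono add.assoc add.commute add.left_commute)
qed

lemma covered_mono:
  assumes "covered X I \<kappa> p l \<delta>" "\<delta> \<le> \<delta>'"
  shows "covered X I \<kappa> p l \<delta>'"
  using assms unfolding covered_def by (meson add_right_mono order_trans)

text \<open>
  After \<open>k\<close> halvings the size \<open>s * 2 ^ k\<close> has come down to \<open>s\<close>, and one round of density \<open>L / \<kappa>\<close>
  finishes. The bound \<open>k / 4 ^ s\<close> is a crude estimate of a rapidly convergent sum, sufficient
  because \<open>s\<close> will be about \<open>sqrt k\<close>.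
\<close>

lemma covered_iterate:
  assumes X: "finite X" and I: "finite I" "I \<noteq> {}" and \<kappa>: "16 \<le> \<kappa>"
    and L: "0 < L" "L \<le> \<kappa>" and s: "1 \<le> s"
  shows "\<exists>p. 0 \<le> p \<and> p \<le> 1 \<and> p \<le> (L + 16 * k) / \<kappa> \<and>
    covered X I \<kappa> p (s * 2 ^ k) ((1 + 1 / L) ^ s - 1 + k / 4 ^ s)"
proof (induction k)
  case 0
  show ?case
    using covered_one_round[OF X I, of "L / \<kappa>" \<kappa> s] \<kappa> L
    by (intro exI[of _ "L / \<kappa>"]) (auto simp: field_simps)
next
  case (Suc k)
  then obtain q where q: "0 \<le> q" "q \<le> 1" "q \<le> (L + 16 * k) / \<kappa>"
    and cov: "covered X I \<kappa> q (s * 2 ^ k) ((1 + 1 / L) ^ s - 1 + k / 4 ^ s)" by auto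
  let ?p = "16 / \<kappa>"
  let ?r = "1 - (1 - ?p) * (1 - q)"
  have p: "0 < ?p" "?p \<le> 1" "?p * \<kappa> = 16" using \<kappa> by auto
  have cov': "covered X I \<kappa> ?r (2 * (s * 2 ^ k))
      ((1 + 1 / L) ^ s - 1 + k / 4 ^ s + 1 / 4 ^ (s * 2 ^ k))"
    using covered_halving_round[OF X I p(1,2) _ p(3) q(1,2) cov] \<kappa> by simp
  have "1 / 4 ^ (s * 2 ^ k) \<le> (1 / 4 ^ s :: real)"
    using s by (intro divide_left_mono power_increasing) auto
  then have le: "(1 + 1 / L) ^ s - 1 + k / 4 ^ s + 1 / 4 ^ (s * 2 ^ k)
      \<le> (1 + 1 / L) ^ s - 1 + Suc k / 4 ^ s"
    by (simp add: add_divide_distrib)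
  have eq: "s * 2 ^ Suc k = 2 * (s * 2 ^ k)" by simp
  have "covered X I \<kappa> ?r (s * 2 ^ Suc k) ((1 + 1 / L) ^ s - 1 + Suc k / 4 ^ s)"
    unfolding eq by (rule covered_mono[OF cov' le])
  moreover have "0 \<le> (1 - ?p) * (1 - q)" "(1 - ?p) * (1 - q) \<le> 1" "0 \<le> ?p * q"
    using p q by (auto intro: mult_le_one)
  moreover have "?r \<le> (L + 16 * Suc k) / \<kappa>"
  proof -
    have "?r = ?p + q - ?p * q" by (simp only: left_diff_distrib right_diff_distrib)
    moreover have "(L + 16 * Suc k) / \<kappa> = (L + 16 * k) / \<kappa> + ?p"
      by (simp add: add_divide_distrib)
    ultimately show ?thesis using q(3) \<open>0 \<le> ?p * q\<close> by linarith
  qed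
  ultimately show ?case by (intro exI[of _ ?r]) auto
qed

theorem spread_family_covered:
  assumes X: "finite X" and I: "finite I" "I \<noteq> {}" and \<kappa>: "16 \<le> \<kappa>"
    and L: "0 < L" "L \<le> \<kappa>" and s: "1 \<le> s"
    and B: "\<And>j. j \<in> I \<Longrightarrow> B j \<subseteq> X \<and> card (B j) \<le> s * 2 ^ k"
    and sp: "spread \<kappa> (card I) I B"
  obtains p where "0 \<le> p" "p \<le> 1" "p \<le> (L + 16 * k) / \<kappa>"
    "binomial_exp p X (misses (B ` I)) \<le> (1 + 1 / L) ^ s - 1 + k / 4 ^ s"
proof -
  obtain p where p: "0 \<le> p" "p \<le> 1" "p \<le> (L + 16 * k) / \<kappa>"
    and cov: "covered X I \<kappa> p (s * 2 ^ k) ((1 + 1 / L) ^ s - 1 + k / 4 ^ s)"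
    using covered_iterate[OF X I \<kappa> L s] by blast
  have "real (card I) > 0" using I by (simp add: card_gt_0_iff)
  moreover have "binomial_exp p X (misses (B ` I))
      \<le> (1 + 1 / L) ^ s - 1 + k / 4 ^ s + (1 - real (card I) / real (card I))"
    using cov B sp unfolding covered_def by blast
  ultimately show ?thesis using p that by simp
qed

section \<open>Rainbow Hamilton cycles form a spread family\<close>

definition cyc_edge :: "nat \<Rightarrow> (nat \<Rightarrow> nat) \<Rightarrow> nat \<Rightarrow> nat set" where
  "cyc_edge n \<pi> i = {Suc (\<pi> i), Suc (\<pi> (Suc i mod n))}"

text \<open>
  A Hamilton cycle is represented by the order in which it visits the vertices, starting at any of
  them and in either direction. This multiplicity is the same for all cycles, so uniform orderings
  give uniform Hamilton cycles.
\<close>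

definition orderings_through :: "nat \<Rightarrow> nat set set \<Rightarrow> (nat \<Rightarrow> nat) set" where
  "orderings_through n F = {\<pi>. \<pi> permutes {..<n} \<and> F \<subseteq> cyc_edge n \<pi> ` {..<n}}"

lemma finite_orderings_through [simp]: "finite (orderings_through n F)"
  unfolding orderings_through_def
  by (rule finite_subset[of _ "{\<pi>. \<pi> permutes {..<n}}"]) (auto simp: finite_permutations)

lemma inj_on_cyc_edge:
  assumes n: "3 \<le> n" and \<pi>: "\<pi> permutes {..<n}"
  shows "inj_on (cyc_edge n \<pi>) {..<n}"
proof (rule inj_onI)
  fix i j assume ij: "i \<in> {..<n}" "j \<in> {..<n}" and eq: "cyc_edge n \<pi> i = cyc_edge n \<pi> j"
  have inj: "\<pi> a = \<pi> b \<longleftrightarrow> a = b" for a b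
    using permutes_inj[OF \<pi>] by (auto dest: injD)
  show "i = j"
  proof (rule ccontr)
    assume "i \<noteq> j"
    then have "i = Suc j mod n" "Suc i mod n = j"
      using eq inj by (auto simp: cyc_edge_def doubleton_eq_iff)
    then show False using ij n by (auto simp: mod_Suc split: if_splits)
  qed
qed

definition rotation :: "nat \<Rightarrow> nat \<Rightarrow> nat \<Rightarrow> nat" where
  "rotation n i k = (if k < n then (k + i) mod n else k)"

lemma rotation_permutes: "rotation n i permutes {..<n}"
proof (rule bij_imp_permutes)
  let ?r = "i mod n"
  define d where "d = n - ?r"
  have id: "((k + i) mod n + d) mod n = k" "(k + d + i) mod n = k" if "k < n" for k
  proof -
    have r: "?r \<le> n" using that by (simp add: less_imp_le)
    have "((k + i) mod n + d) mod n = (k + d + ?r) mod n"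
      by (metis add.assoc add.commute mod_add_left_eq mod_add_right_eq)
    also have "k + d + ?r = k + n" using r by (simp add: d_def)
    finally show "((k + i) mod n + d) mod n = k" using that by simp
    have "(k + d + i) mod n = (k + d + ?r) mod n" by (simp add: mod_add_right_eq)
    also have "k + d + ?r = k + n" using r by (simp add: d_def)
    finally show "(k + d + i) mod n = k" using that by simp
  qed
  show "bij_betw (rotation n i) {..<n} {..<n}"
    by (rule bij_betw_byWitness[where f' = "rotation n d"])
      (auto simp: rotation_def id[unfolded mod_add_left_eq] mod_add_left_eq)
qed (auto simp: rotation_def)

lemma cyc_edge_rotation:
  assumes "k < n"
  shows "cyc_edge n (\<pi> \<circ> rotation n i) k = cyc_edge n \<pi> (rotation n i k)"
  using assms by (simp add: cyc_edge_def rotation_def mod_simps)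

lemma orderings_through_rotation:
  assumes "\<pi> \<in> orderings_through n F"
  shows "\<pi> \<circ> rotation n i \<in> orderings_through n F"
proof -
  have "cyc_edge n (\<pi> \<circ> rotation n i) ` {..<n} = cyc_edge n \<pi> ` rotation n i ` {..<n}"
    unfolding image_image by (intro image_cong refl) (simp add: cyc_edge_rotation)
  also have "rotation n i ` {..<n} = {..<n}" by (rule permutes_image[OF rotation_permutes])
  finally have "cyc_edge n (\<pi> \<circ> rotation n i) ` {..<n} = cyc_edge n \<pi> ` {..<n}" .
  then show ?thesis
    using assms permutes_compose[OF rotation_permutes, of \<pi> n] unfolding orderings_through_def by blast
qed

lemma comp_permutes_cancel:
  assumes "\<rho> permutes S" "\<pi> \<circ> \<rho> = \<pi>' \<circ> \<rho>"
  shows "\<pi> = \<pi>'"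
  using assms(2) permutes_surj[OF assms(1)] by (metis comp_apply ext surjD)

text \<open>
  By rotation, \<open>e\<close> may be assumed to be the closing edge, at the cost of a factor \<open>n\<close>.
\<close>

lemma orderings_ending_at_edge:
  assumes n: "0 < n"
  shows "card (orderings_through n (insert e F))
    \<le> n * card {\<pi> \<in> orderings_through n (insert e F). cyc_edge n \<pi> (n - 1) = e}"
proof -
  let ?P = "orderings_through n (insert e F)"
  let ?Last = "{\<pi> \<in> ?P. cyc_edge n \<pi> (n - 1) = e}"
  have "card {\<pi> \<in> ?P. cyc_edge n \<pi> i = e} \<le> card ?Last" if i: "i < n" for i
  proof (rule card_inj_on_le)
    show "inj_on (\<lambda>\<pi>. \<pi> \<circ> rotation n (Suc i)) {\<pi> \<in> ?P. cyc_edge n \<pi> i = e}"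
      by (rule inj_onI) (rule comp_permutes_cancel[OF rotation_permutes])
    have "rotation n (Suc i) (n - 1) = i" using n i by (simp add: rotation_def)
    then show "(\<lambda>\<pi>. \<pi> \<circ> rotation n (Suc i)) ` {\<pi> \<in> ?P. cyc_edge n \<pi> i = e} \<subseteq> ?Last"
      using n by (auto simp: cyc_edge_rotation intro: orderings_through_rotation)
  qed simp
  note le = this
  have "?P = (\<Union>i<n. {\<pi> \<in> ?P. cyc_edge n \<pi> i = e})"
    by (auto simp: orderings_through_def)
  then have "card ?P \<le> (\<Sum>i<n. card {\<pi> \<in> ?P. cyc_edge n \<pi> i = e})"
    using card_UN_le[of "{..<n}" "\<lambda>i. {\<pi> \<in> ?P. cyc_edge n \<pi> i = e}"] by simp
  also have "\<dots> \<le> (\<Sum>i<n. card ?Last)" using le by (intro sum_mono) auto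
  finally show ?thesis by simp
qed

text \<open>
  All rotations of an ordering pass through the same edges, and exactly one of them ends at \<open>v\<close>.
  This factor \<open>n\<close> compensates the loss in \<open>orderings_ending_at_edge\<close>.
\<close>

lemma orderings_ending_at_vertex:
  assumes n: "0 < n"
  shows "n * card {\<pi> \<in> orderings_through n F. Suc (\<pi> (n - 1)) = v} \<le> card (orderings_through n F)"
proof -
  let ?P = "orderings_through n F"
  let ?Q = "{\<pi> \<in> ?P. Suc (\<pi> (n - 1)) = v}"
  have "card ({..<n} \<times> ?Q) \<le> card ?P"
  proof (rule card_inj_on_le[where f = "\<lambda>(i, \<pi>). \<pi> \<circ> rotation n i"])
    show "inj_on (\<lambda>(i, \<pi>). \<pi> \<circ> rotation n i) ({..<n} \<times> ?Q)"
    proof (rule inj_onI)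
      fix x y
      assume x: "x \<in> {..<n} \<times> ?Q" and y: "y \<in> {..<n} \<times> ?Q"
        and xy: "(\<lambda>(i, \<pi>). \<pi> \<circ> rotation n i) x = (\<lambda>(i, \<pi>). \<pi> \<circ> rotation n i) y"
      obtain i \<pi> i' \<pi>' where split: "x = (i, \<pi>)" "y = (i', \<pi>')" by (cases x, cases y)
      have i: "i < n" "i' < n" and eq: "\<pi> \<circ> rotation n i = \<pi>' \<circ> rotation n i'"
        and \<pi>: "\<pi> \<in> orderings_through n F" and \<pi>': "\<pi>' \<in> orderings_through n F"
        and v: "\<pi>' (n - 1) = \<pi> (n - 1)"
        using x y xy split by auto
      \<comment> \<open>the position to which the rotation has moved the last vertex \<open>v\<close> determines \<open>i\<close>\<close>
      let ?k = "n - 1 - i"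
      have "rotation n i ?k = n - 1" using i by (simp add: rotation_def)
      then have "\<pi>' (rotation n i' ?k) = \<pi>' (n - 1)"
        using fun_cong[OF eq, of ?k] v by simp
      then have "rotation n i' ?k = n - 1"
        using \<pi>' permutes_inj by (auto simp: orderings_through_def dest: injD)
      then have "(n - 1 - i + i') mod n = n - 1" using i by (simp add: rotation_def)
      then have "i = i'"
        using i by (cases "n - 1 - i + i' < n") (auto simp: mod_if split: if_splits)
      then show "x = y"
        using eq comp_permutes_cancel[OF rotation_permutes] split by auto
    qed
  qed (auto intro: orderings_through_rotation)
  then show ?thesis by (simp add: card_cartesian_product)
qed

definition prefix_rev :: "nat \<Rightarrow> nat \<Rightarrow> nat" where
  "prefix_rev j k = (if k \<le> j then j - k else k)"

lemma prefix_rev_permutes: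
  assumes "j < n"
  shows "prefix_rev j permutes {..<n}"
proof (rule bij_imp_permutes)
  show "bij_betw (prefix_rev j) {..<n} {..<n}"
    by (rule bij_betw_byWitness[where f' = "prefix_rev j"])
      (use assms in \<open>auto simp: prefix_rev_def\<close>)
qed (use assms in \<open>auto simp: prefix_rev_def\<close>)

text \<open>
  Reversing the initial segment up to position \<open>j\<close> is a 2-opt move: it exchanges the closing edge
  and the edge at position \<open>j\<close> for two new ones, and keeps all the others.
\<close>

lemma two_opt_keeps:
  assumes \<pi>: "\<pi> \<in> orderings_through n F" and j: "j < n - 1"
    and last: "cyc_edge n \<pi> (n - 1) \<notin> F" and cut: "cyc_edge n \<pi> j \<notin> F"
  shows "\<pi> \<circ> prefix_rev j \<in> orderings_through n F"
proof -
  have "f \<in> cyc_edge n (\<pi> \<circ> prefix_rev j) ` {..<n}" if f: "f \<in> F" for f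
  proof -
    obtain i where i: "i < n" "f = cyc_edge n \<pi> i"
      using \<pi> f by (auto simp: orderings_through_def)
    have ne: "i \<noteq> n - 1" "i \<noteq> j" using f i last cut by auto
    show ?thesis
    proof (cases "i < j")
      case True
      then have "cyc_edge n (\<pi> \<circ> prefix_rev j) (j - 1 - i) = f"
        using i j by (auto simp: cyc_edge_def prefix_rev_def Suc_diff_Suc insert_commute)
      then show ?thesis using j by (intro image_eqI[of _ _ "j - 1 - i"]) auto
    next
      case False
      then have "cyc_edge n (\<pi> \<circ> prefix_rev j) i = f"
        using i j ne by (auto simp: cyc_edge_def prefix_rev_def)
      then show ?thesis using i by auto
    qed
  qed
  moreover have "\<pi> \<circ> prefix_rev j permutes {..<n}"
    using \<pi> j by (intro permutes_compose prefix_rev_permutes) (auto simp: orderings_through_def)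
  ultimately show ?thesis by (auto simp: orderings_through_def)
qed

text \<open>
  Requiring one further edge \<open>e\<close> divides the number of orderings by at least
  \<open>(n - 1 - card F) / 2\<close>. Indeed, an
  ordering whose closing edge is \<open>e\<close> can be switched by reversing any of at least \<open>n - 1 - card F\<close>
  initial segments, so that the edges of \<open>F\<close> are kept. The result determines the move: its last
  vertex is an end of \<open>e\<close>, and the position of the other end of \<open>e\<close> is the place of the cut. The
  factor \<open>2\<close> counts the two ends of \<open>e\<close>.
\<close>

lemma two_opt_count:
  assumes n: "3 \<le> n" and F: "finite F" and e: "e \<notin> F"
  shows "card (orderings_through n (insert e F)) * (n - 1 - card F)
    \<le> 2 * card (orderings_through n F)"
proof (cases "orderings_through n (insert e F) = {}")
  case False
  let ?Last = "{\<pi> \<in> orderings_through n (insert e F). cyc_edge n \<pi> (n - 1) = e}"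
  let ?J = "\<lambda>\<pi>. {j \<in> {..<n - 1}. cyc_edge n \<pi> j \<notin> F}"
  let ?Q = "{\<pi> \<in> orderings_through n F. Suc (\<pi> (n - 1)) \<in> e}"
  have J: "n - 1 - card F \<le> card (?J \<pi>)" if "\<pi> \<in> ?Last" for \<pi>
  proof -
    have "inj_on (cyc_edge n \<pi>) {..<n}"
      using that n by (intro inj_on_cyc_edge) (auto simp: orderings_through_def)
    then have "card {j \<in> {..<n - 1}. cyc_edge n \<pi> j \<in> F} \<le> card F"
      using F by (intro card_inj_on_le[where f = "cyc_edge n \<pi>"]) (auto intro: inj_on_subset)
    moreover have "?J \<pi> = {..<n - 1} - {j \<in> {..<n - 1}. cyc_edge n \<pi> j \<in> F}" by auto
    then have "card (?J \<pi>) = card {..<n - 1} - card {j \<in> {..<n - 1}. cyc_edge n \<pi> j \<in> F}"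
      by (simp only:) (rule card_Diff_subset, auto)
    ultimately show ?thesis by simp
  qed
  have "card (Sigma ?Last ?J) \<le> card ?Q"
  proof (rule card_inj_on_le[where f = "\<lambda>(\<pi>, j). \<pi> \<circ> prefix_rev j"])
    show "(\<lambda>(\<pi>, j). \<pi> \<circ> prefix_rev j) ` Sigma ?Last ?J \<subseteq> ?Q"
    proof
      fix \<rho> assume "\<rho> \<in> (\<lambda>(\<pi>, j). \<pi> \<circ> prefix_rev j) ` Sigma ?Last ?J"
      then obtain \<pi> j where \<rho>: "\<rho> = \<pi> \<circ> prefix_rev j"
        and \<pi>: "\<pi> \<in> orderings_through n (insert e F)"
        and last: "cyc_edge n \<pi> (n - 1) = e"
        and j: "j \<in> {..<n - 1}" and cut: "cyc_edge n \<pi> j \<notin> F"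
        by auto
      have "\<pi> \<in> orderings_through n F" using \<pi> by (auto simp: orderings_through_def)
      then have "\<pi> \<circ> prefix_rev j \<in> orderings_through n F"
        using j cut last e by (intro two_opt_keeps) auto
      moreover have "Suc ((\<pi> \<circ> prefix_rev j) (n - 1)) \<in> cyc_edge n \<pi> (n - 1)"
        using j by (simp add: cyc_edge_def prefix_rev_def)
      ultimately show "\<rho> \<in> ?Q" using \<rho> last by simp
    qed
    show "inj_on (\<lambda>(\<pi>, j). \<pi> \<circ> prefix_rev j) (Sigma ?Last ?J)"
    proof (rule inj_onI)
      fix x y
      assume x: "x \<in> Sigma ?Last ?J" and y: "y \<in> Sigma ?Last ?J"
        and xy: "(\<lambda>(\<pi>, j). \<pi> \<circ> prefix_rev j) x = (\<lambda>(\<pi>, j). \<pi> \<circ> prefix_rev j) y"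
      obtain \<pi> j \<pi>' j' where split: "x = (\<pi>, j)" "y = (\<pi>', j')" by (cases x, cases y)
      have j: "j < n - 1" "j' < n - 1"
        and eq: "\<pi> \<circ> prefix_rev j = \<pi>' \<circ> prefix_rev j'"
        and \<pi>': "\<pi>' \<in> orderings_through n (insert e F)"
        and last: "cyc_edge n \<pi>' (n - 1) = cyc_edge n \<pi> (n - 1)"
        using x y xy split by auto
      \<comment> \<open>both moves keep the last vertex, hence both orderings started at the other end of \<open>e\<close>\<close>
      have "\<pi> (n - 1) = \<pi>' (n - 1)"
        using fun_cong[OF eq, of "n - 1"] j by (simp add: prefix_rev_def)
      moreover have "Suc (n - 1) mod n = 0" using n by simp
      ultimately have "\<pi> 0 = \<pi>' 0"
        using last by (auto simp: cyc_edge_def doubleton_eq_iff)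
      also have "\<pi> 0 = \<pi>' (prefix_rev j' j)"
        using fun_cong[OF eq, of j] by (simp add: prefix_rev_def)
      finally have "prefix_rev j' j = 0"
        using \<pi>' permutes_inj by (auto simp: orderings_through_def dest: injD)
      then have "j = j'" by (auto simp: prefix_rev_def split: if_splits)
      moreover from this have "\<pi> = \<pi>'"
        using eq comp_permutes_cancel[OF prefix_rev_permutes[of j' n]] less_diff_conv j(2) by simp
      ultimately show "x = y" using split by simp
    qed
  qed simp
  moreover have "card ?Last * (n - 1 - card F) \<le> card (Sigma ?Last ?J)"
    using sum_mono[of ?Last "\<lambda>_. n - 1 - card F" "\<lambda>\<pi>. card (?J \<pi>)"] J by simp
  moreover have "n * card ?Q \<le> 2 * card (orderings_through n F)"
  proof -
    obtain a b where ab: "e = {a, b}"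
      using False by (auto simp: orderings_through_def cyc_edge_def)
    have "?Q = {\<pi> \<in> orderings_through n F. Suc (\<pi> (n - 1)) = a}
        \<union> {\<pi> \<in> orderings_through n F. Suc (\<pi> (n - 1)) = b}" using ab by auto
    then have "card ?Q \<le> card {\<pi> \<in> orderings_through n F. Suc (\<pi> (n - 1)) = a}
        + card {\<pi> \<in> orderings_through n F. Suc (\<pi> (n - 1)) = b}"
      by (metis (lifting) card_Un_le)
    then have "n * card ?Q \<le> n * (card {\<pi> \<in> orderings_through n F. Suc (\<pi> (n - 1)) = a}
        + card {\<pi> \<in> orderings_through n F. Suc (\<pi> (n - 1)) = b})" by simp
    also have "\<dots> \<le> 2 * card (orderings_through n F)"
      using n orderings_ending_at_vertex[of n F a] orderings_ending_at_vertex[of n F b]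
      by (simp add: distrib_left)
    finally show ?thesis .
  qed
  moreover have "card (orderings_through n (insert e F)) \<le> n * card ?Last"
    using n by (intro orderings_ending_at_edge) auto
  ultimately have "card (orderings_through n (insert e F)) * (n - 1 - card F)
      \<le> n * (card ?Last * (n - 1 - card F))" "card ?Last * (n - 1 - card F) \<le> card ?Q"
    "n * card ?Q \<le> 2 * card (orderings_through n F)"
    by (simp_all flip: mult.assoc)
  then show ?thesis by (meson le_trans mult_le_mono2)
qed simp

text \<open>
  Iterates \<open>two_opt_count\<close>; using \<open>n - card F \<le> 2 * (n - 1 - card F)\<close>, valid except for the last
  edge, each step costs a factor \<open>4 / (n - card F)\<close>. The last edge of a cycle is forced by the
  others and is treated separately.
\<close>

lemma card_orderings_through_le:
  assumes n: "3 \<le> n" and F: "finite F"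
  shows "card (orderings_through n F) \<le> 4 ^ card F * fact (n - card F)"
  using F
proof (induction F)
  case empty
  show ?case by (simp add: orderings_through_def card_permutations)
next
  case (insert e F)
  let ?t = "card F"
  show ?case
  proof (cases "orderings_through n (insert e F) = {}")
    case False
    then obtain \<pi> where "insert e F \<subseteq> cyc_edge n \<pi> ` {..<n}"
      by (auto simp: orderings_through_def)
    then have "card (insert e F) \<le> card (cyc_edge n \<pi> ` {..<n})" by (intro card_mono) auto
    also have "\<dots> \<le> n" using card_image_le[of "{..<n}" "cyc_edge n \<pi>"] by simp
    finally have t: "?t < n" using insert.hyps by simp
    have step: "card (orderings_through n (insert e F)) * (n - ?t) \<le> 4 * card (orderings_through n F)"
    proof (cases "?t = n - 1")
      case True
      have "orderings_through n (insert e F) \<subseteq> orderings_through n F"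
        by (auto simp: orderings_through_def)
      then have "card (orderings_through n (insert e F)) \<le> card (orderings_through n F)"
        by (intro card_mono) simp
      then show ?thesis using True t by simp
    next
      case False
      then have "n - ?t \<le> 2 * (n - 1 - ?t)" using t by simp
      then have "card (orderings_through n (insert e F)) * (n - ?t)
          \<le> card (orderings_through n (insert e F)) * (2 * (n - 1 - ?t))" by (rule mult_le_mono2)
      also have "\<dots> \<le> 2 * (2 * card (orderings_through n F))"
        using two_opt_count[OF n insert.hyps] by (simp add: mult.commute)
      finally show ?thesis by simp
    qed
    also have "4 * card (orderings_through n F) \<le> 4 * (4 ^ ?t * fact (n - ?t))"
      using insert.IH by simp
    also have "fact (n - ?t) = (n - ?t) * fact (n - Suc ?t)"
      using t by (simp add: fact_reduce)
    finally have "card (orderings_through n (insert e F)) * (n - ?t)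
        \<le> (4 ^ Suc ?t * fact (n - Suc ?t)) * (n - ?t)" by (simp add: algebra_simps)
    then show ?thesis using t insert.hyps by simp
  qed simp
qed

lemma card_permutations_agreeing_le:
  assumes S: "finite S" and K: "K \<subseteq> S" and \<tau>: "\<tau> permutes S"
  shows "card {\<sigma>. \<sigma> permutes S \<and> (\<forall>i\<in>K. \<sigma> i = \<tau> i)} \<le> fact (card S - card K)"
proof -
  have "card {\<sigma>. \<sigma> permutes S \<and> (\<forall>i\<in>K. \<sigma> i = \<tau> i)} \<le> card {\<rho>. \<rho> permutes S - K}"
  proof (rule card_inj_on_le[where f = "\<lambda>\<sigma>. inv \<tau> \<circ> \<sigma>"])
    show "inj_on (\<lambda>\<sigma>. inv \<tau> \<circ> \<sigma>) {\<sigma>. \<sigma> permutes S \<and> (\<forall>i\<in>K. \<sigma> i = \<tau> i)}"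
      using permutes_inj[OF permutes_inv[OF \<tau>]]
      by (intro inj_onI) (simp add: fun_eq_iff inj_eq)
    show "(\<lambda>\<sigma>. inv \<tau> \<circ> \<sigma>) ` {\<sigma>. \<sigma> permutes S \<and> (\<forall>i\<in>K. \<sigma> i = \<tau> i)} \<subseteq> {\<rho>. \<rho> permutes S - K}"
    proof clarify
      fix \<sigma> assume \<sigma>: "\<sigma> permutes S" "\<forall>i\<in>K. \<sigma> i = \<tau> i"
      have "inv \<tau> \<circ> \<sigma> permutes S"
        using \<sigma>(1) permutes_inv[OF \<tau>] by (rule permutes_compose)
      then show "inv \<tau> \<circ> \<sigma> permutes S - K"
        by (rule permutes_superset) (use \<sigma> K permutes_inverses[OF \<tau>] in auto)
    qed
    show "finite {\<rho>. \<rho> permutes S - K}" using S by (simp add: finite_permutations)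
  qed
  also have "\<dots> = fact (card S - card K)"
    using S K finite_subset[OF K S] by (simp add: card_permutations card_Diff_subset)
  finally show ?thesis .
qed

text \<open>
  A cyclic order of the vertices together with an assignment of colours to the positions.
\<close>

definition arrangements :: "nat \<Rightarrow> ((nat \<Rightarrow> nat) \<times> (nat \<Rightarrow> nat)) set" where
  "arrangements n = {\<pi>. \<pi> permutes {..<n}} \<times> {\<sigma>. \<sigma> permutes {..<n}}"

definition rainbow_cycle :: "nat \<Rightarrow> (nat \<Rightarrow> nat) \<times> (nat \<Rightarrow> nat) \<Rightarrow> (nat set \<times> nat) set" where
  "rainbow_cycle n = (\<lambda>(\<pi>, \<sigma>). (\<lambda>i. (cyc_edge n \<pi> i, Suc (\<sigma> i))) ` {..<n})"

lemma finite_arrangements [simp]: "finite (arrangements n)"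
  by (simp add: arrangements_def finite_permutations)

lemma card_arrangements: "card (arrangements n) = (fact n)\<^sup>2"
  by (simp add: arrangements_def card_permutations card_cartesian_product power2_eq_square)

lemma inj_on_fst_rainbow_cycle:
  assumes "3 \<le> n" "\<pi> permutes {..<n}"
  shows "inj_on fst (rainbow_cycle n (\<pi>, \<sigma>))"
  using inj_on_cyc_edge[OF assms] by (auto simp: rainbow_cycle_def inj_on_def)

text \<open>
  For a fixed order of the vertices, the edges of \<open>T\<close> have determined positions, at which the
  colours are prescribed; hence at most \<open>fact (n - card T)\<close> colour assignments remain.
\<close>

lemma card_rainbow_cycles_through_le:
  assumes n: "3 \<le> n"
  shows "card {a \<in> arrangements n. T \<subseteq> rainbow_cycle n a} \<le> 4 ^ card T * (fact (n - card T))\<^sup>2"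
proof (cases "{a \<in> arrangements n. T \<subseteq> rainbow_cycle n a} = {}")
  case True
  then show ?thesis by (metis card.empty le0)
next
  case False
  let ?t = "card T"
  let ?C = "\<lambda>\<pi>. {\<sigma>. \<sigma> permutes {..<n} \<and> T \<subseteq> rainbow_cycle n (\<pi>, \<sigma>)}"
  obtain \<pi>0 \<sigma>0 where 0: "\<pi>0 permutes {..<n}" "T \<subseteq> rainbow_cycle n (\<pi>0, \<sigma>0)"
    using False by (auto simp: arrangements_def)
  then have cardT: "card (fst ` T) = ?t"
    using inj_on_fst_rainbow_cycle[OF n] by (intro card_image) (meson inj_on_subset)
  have finT: "finite T" using 0(2) finite_subset by (fastforce simp: rainbow_cycle_def)
  have C: "card (?C \<pi>) \<le> fact (n - ?t)" if \<pi>: "\<pi> permutes {..<n}" for \<pi>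
  proof (cases "?C \<pi> = {}")
    case True
    then show ?thesis by (metis card.empty le0)
  next
    case False
    then obtain \<tau> where \<tau>: "\<tau> permutes {..<n}" "T \<subseteq> rainbow_cycle n (\<pi>, \<tau>)" by auto
    define K where "K = {i \<in> {..<n}. (cyc_edge n \<pi> i, Suc (\<tau> i)) \<in> T}"
    have inj: "inj_on (cyc_edge n \<pi>) {..<n}" by (rule inj_on_cyc_edge[OF n \<pi>])
    have "T = (\<lambda>i. (cyc_edge n \<pi> i, Suc (\<tau> i))) ` K"
      using \<tau>(2) by (auto simp: K_def rainbow_cycle_def)
    moreover have "inj_on (\<lambda>i. (cyc_edge n \<pi> i, Suc (\<tau> i))) K"
      using inj by (auto simp: K_def inj_on_def)
    ultimately have "?t = card K" by (simp add: card_image)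
    have "?C \<pi> \<subseteq> {\<sigma>. \<sigma> permutes {..<n} \<and> (\<forall>i\<in>K. \<sigma> i = \<tau> i)}"
    proof clarify
      fix \<sigma> i assume \<sigma>: "T \<subseteq> rainbow_cycle n (\<pi>, \<sigma>)" and i: "i \<in> K"
      then have "(cyc_edge n \<pi> i, Suc (\<tau> i)) \<in> rainbow_cycle n (\<pi>, \<sigma>)" by (auto simp: K_def)
      then obtain k where k: "k < n" "cyc_edge n \<pi> i = cyc_edge n \<pi> k" "\<tau> i = \<sigma> k"
        by (auto simp: rainbow_cycle_def)
      then have "i = k" using inj i by (auto simp: K_def dest: inj_onD)
      then show "\<sigma> i = \<tau> i" using k by simp
    qed
    then have "card (?C \<pi>) \<le> card {\<sigma>. \<sigma> permutes {..<n} \<and> (\<forall>i\<in>K. \<sigma> i = \<tau> i)}"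
      by (intro card_mono finite_subset[OF _ finite_permutations[of "{..<n}"]]) auto
    also have "\<dots> \<le> fact (card {..<n} - card K)"
      using \<tau>(1) by (intro card_permutations_agreeing_le) (auto simp: K_def)
    finally show ?thesis using \<open>?t = card K\<close> by simp
  qed
  have "{a \<in> arrangements n. T \<subseteq> rainbow_cycle n a}
      \<subseteq> Sigma (orderings_through n (fst ` T)) ?C"
    by (fastforce simp: arrangements_def orderings_through_def rainbow_cycle_def)
  then have "card {a \<in> arrangements n. T \<subseteq> rainbow_cycle n a}
      \<le> card (Sigma (orderings_through n (fst ` T)) ?C)"
    by (intro card_mono finite_SigmaI finite_orderings_through)
      (auto intro: finite_subset[OF _ finite_permutations[of "{..<n}"]])
  also have "\<dots> = (\<Sum>\<pi>\<in>orderings_through n (fst ` T). card (?C \<pi>))"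
    by (intro card_SigmaI) (auto intro: finite_subset[OF _ finite_permutations[of "{..<n}"]])
  also have "\<dots> \<le> (\<Sum>\<pi>\<in>orderings_through n (fst ` T). fact (n - ?t))"
    using C by (intro sum_mono) (auto simp: orderings_through_def)
  also have "\<dots> = card (orderings_through n (fst ` T)) * fact (n - ?t)" by simp
  also have "\<dots> \<le> (4 ^ ?t * fact (n - ?t)) * fact (n - ?t)"
    using card_orderings_through_le[OF n, of "fst ` T"] finT cardT by (intro mult_le_mono1) simp
  finally show ?thesis by (simp add: power2_eq_square mult.assoc)
qed

text \<open>
  A falling factorial satisfies \<open>n! / (n - t)! \<ge> (n / e) ^ t\<close>, since it equals \<open>n choose t\<close> times
  \<open>t!\<close>, where \<open>n choose t \<ge> (n / t) ^ t\<close> and \<open>t! \<ge> (t / e) ^ t\<close>; and \<open>e < 3\<close>.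
\<close>

lemma falling_factorial_lower:
  assumes "t \<le> n"
  shows "real n ^ t * fact (n - t) \<le> 3 ^ t * fact n"
proof -
  have "real t ^ t / fact t \<le> exp (real t)"
  proof -
    have "real t ^ t / fact t = (\<Sum>k\<in>{t}. inverse (fact k) *\<^sub>R real t ^ k)" by (simp add: field_simps)
    also have "\<dots> \<le> (\<Sum>k. inverse (fact k) *\<^sub>R real t ^ k)"
      by (intro sum_le_suminf summable_exp_generic) auto
    finally show ?thesis by (simp add: exp_def)
  qed
  also have "\<dots> \<le> 3 ^ t"
    using power_mono[OF exp_le, of t] by (simp add: exp_of_nat_mult[symmetric])
  finally have tt: "real t ^ t \<le> 3 ^ t * fact t" by (simp add: field_simps)
  have "(real n / real t) ^ t \<le> real (n choose t)"
    using assms by (rule binomial_ge_n_over_k_pow_k)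
  then have "real n ^ t \<le> real (n choose t) * real t ^ t"
    by (cases "t = 0") (auto simp: field_simps)
  also have "\<dots> \<le> real (n choose t) * (3 ^ t * fact t)" using tt by (intro mult_left_mono) auto
  finally have "real n ^ t * fact (n - t) \<le> real (n choose t) * (3 ^ t * fact t) * fact (n - t)"
    by (intro mult_right_mono) auto
  also have "\<dots> = 3 ^ t * real (fact t * fact (n - t) * (n choose t))" by simp
  also have "\<dots> = 3 ^ t * fact n" unfolding binomial_fact_lemma[OF assms] by simp
  finally show ?thesis .
qed

text \<open>
  The constant is \<open>36 = 4 * 3\<^sup>2\<close>: the factor \<open>4\<close> comes from the orderings, and each of the two
  quotients of factorials contributes a factor \<open>3\<close> bounding \<open>e\<close>.
\<close>

lemma rainbow_cycles_spread:
  assumes n: "3 \<le> n"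
  shows "spread ((real n)\<^sup>2 / 36) (card (arrangements n)) (arrangements n) (rainbow_cycle n)"
  unfolding spread_def
proof (intro allI impI)
  fix T :: "(nat set \<times> nat) set" assume T: "finite T"
  let ?t = "card T"
  show "real (card {a \<in> arrangements n. T \<subseteq> rainbow_cycle n a})
      \<le> card (arrangements n) / ((real n)\<^sup>2 / 36) ^ ?t"
  proof (cases "{a \<in> arrangements n. T \<subseteq> rainbow_cycle n a} = {}")
    case True
    show ?thesis unfolding True by simp
  next
    case False
    then obtain \<pi> \<sigma> where "T \<subseteq> rainbow_cycle n (\<pi>, \<sigma>)" by auto
    then have "?t \<le> card (rainbow_cycle n (\<pi>, \<sigma>))"
      by (intro card_mono) (auto simp: rainbow_cycle_def)
    also have "\<dots> \<le> n"
      unfolding rainbow_cycle_def using card_image_le[of "{..<n}"] by (metis card_lessThan case_prod_conv finite_lessThan)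
    finally have t: "?t \<le> n" .
    have "real (card {a \<in> arrangements n. T \<subseteq> rainbow_cycle n a}) * ((real n)\<^sup>2) ^ ?t
        \<le> real (4 ^ ?t * (fact (n - ?t))\<^sup>2) * ((real n)\<^sup>2) ^ ?t"
      using card_rainbow_cycles_through_le[OF n, of T] by (intro mult_right_mono) (simp_all only: of_nat_le_iff, simp)
    also have "\<dots> = 4 ^ ?t * (real n ^ ?t * fact (n - ?t))\<^sup>2"
      by (simp add: power_mult_distrib power2_eq_square algebra_simps)
    also have "\<dots> \<le> 4 ^ ?t * (3 ^ ?t * fact n)\<^sup>2"
      using falling_factorial_lower[OF t] by (intro mult_left_mono power_mono) auto
    also have "\<dots> = 36 ^ ?t * card (arrangements n)"
    proof -
      have "(36::real) ^ ?t = 4 ^ ?t * (3 ^ ?t)\<^sup>2"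
        by (simp add: power2_eq_square flip: power_mult_distrib)
      then show ?thesis by (simp add: card_arrangements power_mult_distrib)
    qed
    finally show ?thesis using n by (simp add: power_divide field_simps)
  qed
qed

section \<open>Fixing the number of edges\<close>

definition bad_colourings :: "'e set \<Rightarrow> 'c set \<Rightarrow> ('e \<times> 'c) set set \<Rightarrow> nat \<Rightarrow> ('e \<times> 'c) set set" where
  "bad_colourings E C H k = {W \<in> colourings E C. card W = k \<and> (\<forall>S\<in>H. \<not> S \<subseteq> W)}"

lemma finite_bad_colourings:
  "finite E \<Longrightarrow> finite C \<Longrightarrow> finite (bad_colourings E C H k)"
  unfolding bad_colourings_def by (simp add: finite_colourings)

lemma exclusive_exp_misses:
  assumes "finite E" "finite C"
  shows "exclusive_exp q C E (misses H)
    = (\<Sum>k\<le>card E. q ^ k * (1 - q * card C) ^ (card E - k) * card (bad_colourings E C H k))"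
proof -
  let ?w = "\<lambda>W. q ^ card W * (1 - q * card C) ^ (card E - card W)"
  have "exclusive_exp q C E (misses H) = (\<Sum>W\<in>{W \<in> colourings E C. \<forall>S\<in>H. \<not> S \<subseteq> W}. ?w W)"
    unfolding exclusive_exp_def misses_def
    using finite_colourings[OF assms] by (intro sum.mono_neutral_cong_right) auto
  also have "\<dots> = (\<Sum>k\<le>card E. \<Sum>W\<in>{W \<in> {W \<in> colourings E C. \<forall>S\<in>H. \<not> S \<subseteq> W}. card W = k}. ?w W)"
    using finite_colourings[OF assms] card_colourings_le[OF assms(1)]
    by (intro sum.group[symmetric]) auto
  also have "\<dots> = (\<Sum>k\<le>card E. \<Sum>W\<in>bad_colourings E C H k. q ^ k * (1 - q * card C) ^ (card E - k))"
    by (intro sum.cong refl) (auto simp: bad_colourings_def)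
  finally show ?thesis by (simp add: mult.commute)
qed

text \<open>
  Double counting of the removal of one coloured edge: every set left by the removal still contains
  no member of \<open>H\<close>, and it can be extended by an uncoloured edge in \<open>(card E - k) * card C\<close> ways.
\<close>

lemma bad_colourings_step:
  assumes E: "finite E" and C: "finite C"
  shows "card (bad_colourings E C H (Suc k)) * Suc k
    \<le> card (bad_colourings E C H k) * ((card E - k) * card C)"
proof -
  let ?B = "bad_colourings E C H"
  have finW: "finite W" if "W \<in> colourings E C" for W
    using that E C by (auto simp: colourings_def intro: finite_subset)
  have "card (?B (Suc k)) * Suc k = card (Sigma (?B (Suc k)) (\<lambda>W. W))"
    using finite_bad_colourings[OF E C] finW
    by (subst card_SigmaI) (auto simp: bad_colourings_def)
  also have "\<dots> \<le> card (Sigma (?B k) (\<lambda>W. (E - fst ` W) \<times> C))"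
  proof (rule card_inj_on_le[where f = "\<lambda>(W, x). (W - {x}, x)"])
    show "inj_on (\<lambda>(W, x). (W - {x}, x)) (Sigma (?B (Suc k)) (\<lambda>W. W))"
      by (rule inj_onI) (auto; blast)
    show "(\<lambda>(W, x). (W - {x}, x)) ` Sigma (?B (Suc k)) (\<lambda>W. W)
        \<subseteq> Sigma (?B k) (\<lambda>W. (E - fst ` W) \<times> C)"
    proof
      fix y assume "y \<in> (\<lambda>(W, x). (W - {x}, x)) ` Sigma (?B (Suc k)) (\<lambda>W. W)"
      then obtain W x where y: "y = (W - {x}, x)" and W: "W \<in> ?B (Suc k)" and x: "x \<in> W" by auto
      have W': "W \<subseteq> E \<times> C" "inj_on fst W" "card W = Suc k" "\<forall>S\<in>H. \<not> S \<subseteq> W"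
        using W by (auto simp: bad_colourings_def colourings_def)
      have "W - {x} \<in> ?B k"
        using W' x finW[of W] W
        by (auto simp: bad_colourings_def colourings_def intro: inj_on_subset)
      moreover have "fst x \<notin> fst ` (W - {x})" using W'(2) x by (auto simp: inj_on_def)
      moreover have "x \<in> E \<times> C" using W' x by auto
      ultimately show "y \<in> Sigma (?B k) (\<lambda>W. (E - fst ` W) \<times> C)" using y by (auto simp: mem_Times_iff)
    qed
    show "finite (Sigma (?B k) (\<lambda>W. (E - fst ` W) \<times> C))"
      using finite_bad_colourings[OF E C] E C by auto
  qed
  also have "\<dots> = (\<Sum>W\<in>?B k. card ((E - fst ` W) \<times> C))"
    using finite_bad_colourings[OF E C] E C by (intro card_SigmaI) auto
  also have "\<dots> = (\<Sum>W\<in>?B k. (card E - k) * card C)"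
  proof (rule sum.cong[OF refl])
    fix W assume "W \<in> ?B k"
    then have W: "W \<in> colourings E C" "card (fst ` W) = k" "fst ` W \<subseteq> E"
      by (auto simp: bad_colourings_def colourings_def card_image)
    then show "card ((E - fst ` W) \<times> C) = (card E - k) * card C"
      using finW by (simp add: card_cartesian_product card_Diff_subset)
  qed
  finally show ?thesis by simp
qed

text \<open>
  The denominator is the number of all colourings of \<open>k\<close> edges, so this is the probability
  that a uniformly random one contains no member of \<open>H\<close>.
\<close>

definition bad_ratio :: "'e set \<Rightarrow> 'c set \<Rightarrow> ('e \<times> 'c) set set \<Rightarrow> nat \<Rightarrow> real" where
  "bad_ratio E C H k = card (bad_colourings E C H k) / ((card E choose k) * card C ^ k)"

lemma bad_ratio_antimono:
  assumes E: "finite E" and C: "finite C" "C \<noteq> {}" and jm: "j \<le> m" "m \<le> card E"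
  shows "bad_ratio E C H m \<le> bad_ratio E C H j"
  using jm
proof (induction rule: dec_induct)
  case base
  then show ?case by simp
next
  case (step k)
  have c: "card C > 0" using C by (simp add: card_gt_0_iff)
  let ?b = "\<lambda>k. card (bad_colourings E C H k)"
  let ?D = "\<lambda>k. (card E choose k) * card C ^ k"
  have D: "?D k > 0" "?D (Suc k) > 0" using step.prems c by simp_all
  have "Suc k * (card E choose Suc k) = (card E - k) * (card E choose k)"
    by (simp only: binomial_absorb_comp binomial_absorption)
  then have DS: "Suc k * ?D (Suc k) = ((card E - k) * card C) * ?D k"
    by (simp only: power_Suc) (metis (no_types, lifting) mult.assoc mult.commute)
  have "Suc k * (?b (Suc k) * ?D k) = (?b (Suc k) * Suc k) * ?D k" by (simp only: mult_ac)
  also have "\<dots> \<le> (?b k * ((card E - k) * card C)) * ?D k"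
    by (rule mult_le_mono1[OF bad_colourings_step[OF E C(1)]])
  also have "\<dots> = ?b k * (((card E - k) * card C) * ?D k)" by (simp only: mult_ac)
  also have "\<dots> = ?b k * (Suc k * ?D (Suc k))" by (simp only: DS)
  also have "\<dots> = Suc k * (?b k * ?D (Suc k))" by (simp only: mult_ac)
  finally have "?b (Suc k) * ?D k \<le> ?b k * ?D (Suc k)" by (simp only: mult_le_cancel1)
  then have "real (?b (Suc k)) * real (?D k) \<le> real (?b k) * real (?D (Suc k))"
    by (metis of_nat_le_iff of_nat_mult)
  then have "bad_ratio E C H (Suc k) \<le> bad_ratio E C H k"
    unfolding bad_ratio_def using D by (simp only: of_nat_0_less_iff frac_le_eq divide_le_eq
      pos_divide_le_eq) (simp add: field_simps)
  then show ?case using step by simp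
qed

text \<open>
  The number of coloured edges is binomial with success probability \<open>q * card C\<close>, and its point
  probabilities are Bernstein polynomials. Its mean is at most \<open>m / 2\<close>, so by Markov's inequality it
  is at most \<open>m\<close> with probability at least \<open>1/2\<close>; in that case failure is at least as likely
  as with \<open>m\<close> edges.
\<close>

lemma bad_ratio_le_exclusive:
  fixes q :: real
  assumes E: "finite E" and C: "finite C" "C \<noteq> {}" and m: "0 < m" "m \<le> card E"
    and q: "0 \<le> q" and qm: "2 * (card E * (q * card C)) \<le> m"
  shows "bad_ratio E C H m \<le> 2 * exclusive_exp q C E (misses H)"
proof -
  let ?N = "card E" and ?x = "q * card C"
  let ?B = "\<lambda>k. Bernstein ?N k ?x"
  have c: "card C > 0" using C by (simp add: card_gt_0_iff)
  have N: "real ?N > 0" using m by simp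
  have x: "0 \<le> ?x" using q by simp
  have "real m \<le> real ?N" using m by simp
  then have "2 * (real ?N * ?x) \<le> real ?N * 1" using qm by linarith
  then have "real ?N * (2 * ?x) \<le> real ?N * 1" by (simp only: mult.left_commute)
  then have "2 * ?x \<le> 1" using N by (simp only: mult_le_cancel_left_pos)
  then have x1: "?x \<le> 1" using x by linarith
  have Bn: "0 \<le> ?B k" for k using Bernstein_nonneg[OF x x1] .
  have r0: "0 \<le> bad_ratio E C H k" for k by (simp add: bad_ratio_def)
  \<comment> \<open>Markov's inequality for the upper tail\<close>
  have "m * (\<Sum>k\<in>{m<..?N}. ?B k) \<le> (\<Sum>k\<in>{m<..?N}. k * ?B k)"
    unfolding sum_distrib_left using Bn by (intro sum_mono mult_right_mono) auto
  also have "\<dots> \<le> (\<Sum>k\<le>?N. k * ?B k)" using Bn by (intro sum_mono2) auto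
  also have "\<dots> = ?N * ?x" by simp
  finally have "2 * (m * (\<Sum>k\<in>{m<..?N}. ?B k)) \<le> real m * 1" using qm by simp
  then have "m * (2 * (\<Sum>k\<in>{m<..?N}. ?B k)) \<le> real m * 1" by (simp only: mult.left_commute)
  then have tail: "2 * (\<Sum>k\<in>{m<..?N}. ?B k) \<le> 1" using m(1) by (simp only: mult_le_cancel_left_pos of_nat_0_less_iff)
  have "{..?N} = {..m} \<union> {m<..?N}" "{..m} \<inter> {m<..?N} = {}" using m by auto
  then have "(\<Sum>k\<le>?N. ?B k) = (\<Sum>k\<le>m. ?B k) + (\<Sum>k\<in>{m<..?N}. ?B k)"
    by (metis finite_atMost finite_greaterThanAtMost sum.union_disjoint)
  then have head: "1 \<le> 2 * (\<Sum>k\<le>m. ?B k)" using tail by simp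
  have "bad_ratio E C H m * 1 \<le> bad_ratio E C H m * (2 * (\<Sum>k\<le>m. ?B k))"
    using head r0 by (intro mult_left_mono) auto
  also have "\<dots> = 2 * (\<Sum>k\<le>m. ?B k * bad_ratio E C H m)" by (simp add: sum_distrib_left mult_ac)
  also have "\<dots> \<le> 2 * (\<Sum>k\<le>m. ?B k * bad_ratio E C H k)"
    using m Bn bad_ratio_antimono[OF E C] by (intro mult_left_mono sum_mono) auto
  also have "\<dots> \<le> 2 * (\<Sum>k\<le>?N. ?B k * bad_ratio E C H k)"
    using m Bn r0 by (intro mult_left_mono sum_mono2) auto
  also have "(\<Sum>k\<le>?N. ?B k * bad_ratio E C H k)
      = (\<Sum>k\<le>?N. q ^ k * (1 - ?x) ^ (?N - k) * card (bad_colourings E C H k))"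
    using c by (intro sum.cong refl) (simp add: Bernstein_def bad_ratio_def power_mult_distrib)
  also have "\<dots> = exclusive_exp q C E (misses H)" by (simp add: exclusive_exp_misses[OF E C(1)])
  finally show ?thesis by simp
qed

lemma card_all_edges: "card (all_edges n) = n choose 2" and finite_all_edges: "finite (all_edges n)"
  by (simp_all add: all_edges_def n_subsets)

lemma has_rainbow_hamilton_cycleI:
  assumes n: "3 \<le> n" and a: "a \<in> arrangements n"
    and sub: "rainbow_cycle n a \<subseteq> (\<lambda>e. (e, c e)) ` E"
  shows "has_rainbow_hamilton_cycle n E c"
proof -
  obtain \<pi> \<sigma> where a': "a = (\<pi>, \<sigma>)" "\<pi> permutes {..<n}" "\<sigma> permutes {..<n}"
    using a by (auto simp: arrangements_def)
  let ?vs = "map (\<lambda>i. Suc (\<pi> i)) [0..<n]"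
  let ?F = "cyc_edge n \<pi> ` {..<n}"
  have "distinct ?vs"
    using permutes_inj[OF a'(2)] by (auto simp: distinct_map inj_on_def dest: injD)
  moreover have "set ?vs = {1..n}"
  proof -
    have "set ?vs = Suc ` \<pi> ` {..<n}" by (auto simp: image_image)
    also have "\<dots> = {1..n}"
      unfolding permutes_image[OF a'(2)] by (simp add: lessThan_atLeast0 atLeastLessThanSuc_atLeastAtMost)
    finally show ?thesis .
  qed
  moreover have "?F = cycle_edges ?vs"
  proof -
    have "cycle_edges ?vs = {cyc_edge n \<pi> i | i. i < n}"
      unfolding cycle_edges_def using n by (intro Collect_cong ex_cong1) (auto simp: cyc_edge_def)
    then show ?thesis by auto
  qed
  ultimately have "hamilton_cycle n ?F" using n unfolding hamilton_cycle_def by auto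
  moreover have mem: "cyc_edge n \<pi> i \<in> E \<and> c (cyc_edge n \<pi> i) = Suc (\<sigma> i)" if "i < n" for i
    using sub that by (auto simp: a' rainbow_cycle_def)
  moreover have "rainbow c ?F"
    unfolding rainbow_def
  proof (rule inj_onI)
    fix e f assume "e \<in> ?F" "f \<in> ?F" and eq: "c e = c f"
    then obtain i j where ij: "i < n" "j < n" "e = cyc_edge n \<pi> i" "f = cyc_edge n \<pi> j" by auto
    then have "\<sigma> i = \<sigma> j" using mem eq by auto
    then show "e = f" using permutes_inj[OF a'(3)] ij by (auto dest: injD)
  qed
  ultimately show ?thesis unfolding has_rainbow_hamilton_cycle_def by blast
qed

lemma rainbow_cycle_subset:
  assumes n: "3 \<le> n" and a: "a \<in> arrangements n"
  shows "rainbow_cycle n a \<subseteq> all_edges n \<times> {1..n}" "card (rainbow_cycle n a) \<le> n"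
    "inj_on fst (rainbow_cycle n a)"
proof -
  obtain \<pi> \<sigma> where a': "a = (\<pi>, \<sigma>)" "\<pi> permutes {..<n}" "\<sigma> permutes {..<n}"
    using a by (auto simp: arrangements_def)
  have "cyc_edge n \<pi> i \<in> all_edges n" "Suc (\<sigma> i) \<in> {1..n}" if i: "i < n" for i
  proof -
    have s: "Suc i mod n < n" "i \<noteq> Suc i mod n" using i n by (auto simp: mod_Suc)
    have "\<pi> i < n" "\<pi> (Suc i mod n) < n" "\<sigma> i < n"
      using permutes_in_image[OF a'(2)] permutes_in_image[OF a'(3)] i s by auto
    moreover have "\<pi> i \<noteq> \<pi> (Suc i mod n)" using permutes_inj[OF a'(2)] s by (auto dest: injD)
    ultimately show "cyc_edge n \<pi> i \<in> all_edges n" "Suc (\<sigma> i) \<in> {1..n}"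
      by (auto simp: cyc_edge_def all_edges_def)
  qed
  then show "rainbow_cycle n a \<subseteq> all_edges n \<times> {1..n}" by (auto simp: a' rainbow_cycle_def)
  have "card (rainbow_cycle n a) \<le> card {..<n}"
    unfolding a' rainbow_cycle_def prod.case by (rule card_image_le) simp
  then show "card (rainbow_cycle n a) \<le> n" by simp
  show "inj_on fst (rainbow_cycle n a)" using inj_on_fst_rainbow_cycle[OF n a'(2)] a' by simp
qed

text \<open>
  The pairs \<open>(E, c)\<close> in the support are equally likely and correspond to their graphs
  \<open>{(e, c e) | e \<in> E}\<close>; a graph that contains the coloured cycle of an arrangement yields a
  rainbow Hamilton cycle.
\<close>

lemma failure_le_bad_ratio:
  assumes n: "3 \<le> n" and m: "m \<le> n choose 2"
  shows "1 - prob_rainbow_hamilton n m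
    \<le> bad_ratio (all_edges n) {1..n} (rainbow_cycle n ` arrangements n) m"
proof -
  let ?A = "{E. E \<subseteq> all_edges n \<and> card E = m}"
  let ?P = "\<lambda>E. PiE_dflt E 0 (\<lambda>_. {1..n})"
  let ?Q = "{(E, c). has_rainbow_hamilton_cycle n E c}"
  let ?f = "\<lambda>E. map_pmf (Pair E) (pmf_of_set (?P E))"
  let ?bad = "bad_colourings (all_edges n) {1..n} (rainbow_cycle n ` arrangements n) m"
  let ?S = "Sigma ?A (\<lambda>E. {c \<in> ?P E. \<not> has_rainbow_hamilton_cycle n E c})"
  have cA: "card ?A = (n choose 2) choose m"
    using n_subsets[OF finite_all_edges, of n m] by (simp add: card_all_edges)
  have finA: "finite ?A" using finite_all_edges by simp
  have neA: "?A \<noteq> {}" using cA m by (metis card.empty binomial_eq_0_iff not_le)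
  have finE: "finite E" if "E \<in> ?A" for E using that finite_all_edges finite_subset by auto
  have cP: "card (?P E) = n ^ m" and finP: "finite (?P E)" if "E \<in> ?A" for E
    using finE[OF that] that by (simp_all add: card_PiE_dflt finite_PiE_dflt)
  have neP: "?P E \<noteq> {}" if "E \<in> ?A" for E
    using cP[OF that] n by (metis card.empty power_not_zero not_numeral_le_zero)
  have "random_coloured_graph n m n = bind_pmf (pmf_of_set ?A) ?f"
    unfolding random_coloured_graph_def
  proof (rule bind_pmf_cong[OF refl])
    fix E assume "E \<in> set_pmf (pmf_of_set ?A)"
    then have E: "E \<in> ?A" using finA neA by simp
    have "Pi_pmf E 0 (\<lambda>_. pmf_of_set {1..n}) = pmf_of_set (?P E)"
      using finE[OF E] n by (intro Pi_pmf_of_set) auto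
    then show "bind_pmf (Pi_pmf E 0 (\<lambda>_. pmf_of_set {1..n})) (\<lambda>c. return_pmf (E, c)) = ?f E"
      by (simp add: map_pmf_def)
  qed
  then have "1 - prob_rainbow_hamilton n m = measure_pmf.prob (bind_pmf (pmf_of_set ?A) ?f) (- ?Q)"
    unfolding prob_rainbow_hamilton_def
    using measure_pmf.prob_compl[of ?Q "bind_pmf (pmf_of_set ?A) ?f"] by (simp add: Compl_eq_Diff_UNIV)
  also have "\<dots> = measure_pmf.expectation (bind_pmf (pmf_of_set ?A) ?f) (indicator (- ?Q))"
    by simp
  also have "\<dots> = (\<Sum>E\<in>?A. measure_pmf.expectation (?f E) (indicator (- ?Q)) /\<^sub>R card ?A)"
    using finA neA finP neP by (intro pmf_expectation_bind_pmf_of_set) auto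
  also have "\<dots> = (\<Sum>E\<in>?A. card {c \<in> ?P E. \<not> has_rainbow_hamilton_cycle n E c} / n ^ m / card ?A)"
  proof (rule sum.cong[OF refl])
    fix E assume E: "E \<in> ?A"
    have "measure_pmf.expectation (?f E) (indicator (- ?Q)) = measure_pmf.prob (pmf_of_set (?P E)) (Pair E -` (- ?Q))"
      by simp
    also have "\<dots> = card (?P E \<inter> Pair E -` (- ?Q)) / card (?P E)"
      by (rule measure_pmf_of_set[OF neP[OF E] finP[OF E]])
    also have "?P E \<inter> Pair E -` (- ?Q) = {c \<in> ?P E. \<not> has_rainbow_hamilton_cycle n E c}" by auto
    finally show "measure_pmf.expectation (?f E) (indicator (- ?Q)) /\<^sub>R card ?A
        = card {c \<in> ?P E. \<not> has_rainbow_hamilton_cycle n E c} / n ^ m / card ?A"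
      using cP[OF E] by (simp add: field_simps)
  qed
  also have "\<dots> = real (\<Sum>E\<in>?A. card {c \<in> ?P E. \<not> has_rainbow_hamilton_cycle n E c}) / n ^ m / card ?A"
    by (simp add: sum_divide_distrib)
  also have "(\<Sum>E\<in>?A. card {c \<in> ?P E. \<not> has_rainbow_hamilton_cycle n E c}) = card ?S"
    using finA finP by (intro card_SigmaI[symmetric]) auto
  also have "real (card ?S) / n ^ m / card ?A \<le> real (card ?bad) / n ^ m / card ?A"
  proof -
    have "card ?S \<le> card ?bad"
    proof (rule card_inj_on_le[where f = "\<lambda>(E, c). (\<lambda>e. (e, c e)) ` E"])
      show "inj_on (\<lambda>(E, c). (\<lambda>e. (e, c e)) ` E) ?S"
      proof (rule inj_onI)
        fix x y assume x: "x \<in> ?S" and y: "y \<in> ?S"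
          and xy: "(\<lambda>(E, c). (\<lambda>e. (e, c e)) ` E) x = (\<lambda>(E, c). (\<lambda>e. (e, c e)) ` E) y"
        obtain E c E' c' where s: "x = (E, c)" "y = (E', c')" by (cases x, cases y)
        have eq: "(\<lambda>e. (e, c e)) ` E = (\<lambda>e. (e, c' e)) ` E'" using xy s by simp
        then have "fst ` (\<lambda>e. (e, c e)) ` E = fst ` (\<lambda>e. (e, c' e)) ` E'" by simp
        then have E: "E = E'" by (simp add: image_image)
        have "c e = c' e" for e
        proof (cases "e \<in> E")
          case True
          then have "(e, c e) \<in> (\<lambda>e. (e, c' e)) ` E'" using eq by auto
          then show ?thesis by auto
        next
          case False
          then show ?thesis using x y s E by (auto simp: PiE_dflt_def)
        qed
        then show "x = y" using s E by auto
      qed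
      show "(\<lambda>(E, c). (\<lambda>e. (e, c e)) ` E) ` ?S \<subseteq> ?bad"
      proof clarify
        fix E c assume E: "E \<subseteq> all_edges n" "m = card E" and c: "c \<in> ?P E"
          and no: "\<not> has_rainbow_hamilton_cycle n E c"
        have "(\<lambda>e. (e, c e)) ` E \<subseteq> all_edges n \<times> {1..n}"
          using E c by (auto simp: PiE_dflt_def)
        moreover have "inj_on fst ((\<lambda>e. (e, c e)) ` E)" by (auto simp: inj_on_def)
        moreover have "card ((\<lambda>e. (e, c e)) ` E) = card E" by (intro card_image) (auto simp: inj_on_def)
        ultimately show "(\<lambda>e. (e, c e)) ` E
            \<in> bad_colourings (all_edges n) {1..n} (rainbow_cycle n ` arrangements n) (card E)"
          using has_rainbow_hamilton_cycleI[OF n] no by (auto simp: bad_colourings_def colourings_def)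
      qed
      show "finite ?bad" by (intro finite_bad_colourings finite_all_edges) simp
    qed
    then show ?thesis by (intro divide_right_mono) auto
  qed
  also have "\<dots> = bad_ratio (all_edges n) {1..n} (rainbow_cycle n ` arrangements n) m"
    by (simp add: bad_ratio_def cA card_all_edges mult.commute)
  finally show ?thesis .
qed

section \<open>The probability of failure\<close>

text \<open>
  With \<open>k\<close> halvings and a last round at \<open>L = k\<close>, the choice \<open>s \<approx> sqrt k\<close> makes both error terms
  \<open>O(1 / s)\<close>: the first is about \<open>s / k\<close>, and the second is far smaller.
\<close>

lemma rounds_error_le:
  assumes s: "1 \<le> s" "s\<^sup>2 \<le> k" "k \<le> (s + 1)\<^sup>2"
  shows "(1 + 1 / real k) ^ s - 1 + k / 4 ^ s \<le> 6 / s"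
proof -
  have k: "real k > 0" using s by (cases k) auto
  have s2: "real s ^ 2 \<le> real k" using s(2) by (metis of_nat_le_iff of_nat_power)
  have "(1 + 1 / real k) ^ s \<le> exp (1 / real k) ^ s"
    using k by (intro power_mono exp_ge_add_one_self) auto
  also have "\<dots> = exp (s / k)" by (simp add: exp_of_nat_mult[symmetric])
  also have "\<dots> \<le> exp (1 / s)"
    using s s2 k by (simp add: field_simps power2_eq_square)
  also have "\<dots> \<le> 1 + 1 / s + (1 / s)\<^sup>2"
    using s by (intro exp_bound) auto
  also have "(1 / real s)\<^sup>2 \<le> 1 / s"
    using s by (simp add: power2_eq_square field_simps)
  finally have 1: "(1 + 1 / real k) ^ s - 1 \<le> 2 / s" by simp
  \<comment> \<open>gives \<open>k \<le> 4 * 2 ^ s\<close>, and half of the exponent in \<open>4 ^ s\<close> is left over\<close>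
  have sq: "(t + 1)\<^sup>2 \<le> 4 * 2 ^ t" for t :: nat
  proof (induction t rule: less_induct)
    case (less t)
    consider "t = 0" | "t = 1" | "t = 2" | u where "t = Suc u" "2 \<le> u"
      by (cases t) (auto, metis One_nat_def Suc_1 not_less_eq_eq le_antisym le_0_eq le_SucE)
    then show ?case
    proof cases
      case 4
      have "(t + 1)\<^sup>2 \<le> 2 * (u + 1)\<^sup>2"
        using 4 mult_le_mono[of 2 u 2 u] by (simp add: power2_eq_square algebra_simps)
      also have "\<dots> \<le> 2 * (4 * 2 ^ u)" using less[of u] 4 by simp
      finally show ?thesis using 4 by simp
    qed (auto simp: power2_eq_square)
  qed
  have "k \<le> 4 * 2 ^ s" using s(3) sq[of s] by simp
  then have "real k \<le> 4 * 2 ^ s" by (metis of_nat_le_iff of_nat_mult of_nat_numeral of_nat_power)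
  then have "k / 4 ^ s \<le> (4 * 2 ^ s) / (2 ^ s * 2 ^ s)"
    by (simp add: divide_right_mono flip: power_mult_distrib)
  also have "\<dots> = 4 / 2 ^ s" by simp
  also have "\<dots> \<le> 4 / s"
    using s of_nat_less_two_power[of s] by (intro divide_left_mono) (auto simp: less_imp_le)
  finally show ?thesis using 1 by simp
qed

text \<open>
  Use \<open>k = \<lceil>log 2 n\<rceil>\<close> halvings and \<open>L = k\<close>. The total density is at most
  \<open>17 * k / \<kappa> = 612 * k / n\<^sup>2\<close>, so the expected number of coloured edges is at most
  \<open>306 * k * n\<close>, and \<open>m \<ge> 612 * k * n\<close> is enough. Since \<open>k \<le> 2.5 * ln n\<close>, this holds when
  \<open>m \<ge> 2000 * n * ln n\<close>.
\<close>

theorem failure_probability_le: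
  assumes n: "100 \<le> n" and m: "2000 * real n * ln n \<le> m" "m \<le> n choose 2"
  shows "1 - prob_rainbow_hamilton n m \<le> 12 / (sqrt (log 2 n) - 1)"
proof -
  define k where "k = nat \<lceil>log 2 n\<rceil>"
  define s where "s = nat \<lfloor>sqrt k\<rfloor>"
  let ?E = "all_edges n" and ?I = "arrangements n" and ?B = "rainbow_cycle n"
  let ?\<kappa> = "(real n)\<^sup>2 / 36"
  have ln: "1 \<le> ln (real n)"
    using n exp_le by (subst ln_ge_iff) auto
  have log5: "5 \<le> log 2 n" using n by (subst le_log_iff) auto
  have klog: "log 2 n \<le> k" "k \<le> log 2 n + 1" using log5 by (auto simp: k_def; linarith)+
  have "real n = 2 powr (log 2 n)" using n by simp
  also have "\<dots> \<le> 2 powr k" using klog by (intro powr_mono) auto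
  finally have "real n \<le> 2 ^ k" by (simp add: powr_realpow)
  then have nk: "n \<le> 2 ^ k" by (metis of_nat_le_iff of_nat_numeral of_nat_power)
  have "log 2 n \<le> 1.5 * ln n"
    using ln2_ge_two_thirds ln by (simp add: log_def field_simps) 
  then have kln: "k \<le> 2.5 * ln n" using klog ln by simp
  have sqk: "2 \<le> sqrt k" using klog log5 by (intro real_le_rsqrt) auto
  have s: "s \<le> sqrt k" "sqrt k \<le> s + 1" "1 \<le> s"
    using sqk by (auto simp: s_def; linarith)+
  have s2: "s\<^sup>2 \<le> k" "k \<le> (s + 1)\<^sup>2"
  proof -
    have "(real s)\<^sup>2 \<le> (sqrt k)\<^sup>2" using s by (intro power_mono) auto
    then have "real (s\<^sup>2) \<le> real k" by simp
    then show "s\<^sup>2 \<le> k" by (simp only: of_nat_le_iff)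
    have "(sqrt k)\<^sup>2 \<le> (real s + 1)\<^sup>2" using s by (intro power_mono) auto
    then have "real k \<le> real ((s + 1)\<^sup>2)" by (simp add: add.commute)
    then show "k \<le> (s + 1)\<^sup>2" by (simp only: of_nat_le_iff)
  qed
  have "100 * real n \<le> (real n)\<^sup>2" using n by (simp add: power2_eq_square)
  moreover have "ln (real n) \<le> real n - 1" using n by (intro ln_le_minus_one) auto
  ultimately have \<kappa>: "16 \<le> ?\<kappa>" "real k \<le> ?\<kappa>" using n kln by simp_all
  obtain p where p: "0 \<le> p" "p \<le> 1" "p \<le> (real k + 16 * k) / ?\<kappa>"
    and cov: "binomial_exp p (?E \<times> {1..n}) (misses (?B ` ?I)) \<le> (1 + 1 / real k) ^ s - 1 + k / 4 ^ s"
  proof (rule spread_family_covered[where X = "?E \<times> {1..n}" and I = ?I and B = ?B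
        and \<kappa> = ?\<kappa> and L = "real k" and s = s and k = k])
    show "?I \<noteq> {}" using card_arrangements[of n] by (metis card.empty fact_nonzero power_not_zero)
    have "2 ^ k \<le> s * 2 ^ k" using s by simp
    then have ns: "n \<le> s * 2 ^ k" by (rule le_trans[OF nk])
    show "?B j \<subseteq> ?E \<times> {1..n} \<and> card (?B j) \<le> s * 2 ^ k" if "j \<in> ?I" for j
    proof
      show "?B j \<subseteq> ?E \<times> {1..n}" using n that by (intro rainbow_cycle_subset(1)) simp_all
      have "card (?B j) \<le> n" using n that by (intro rainbow_cycle_subset(2)) simp_all
      then show "card (?B j) \<le> s * 2 ^ k" using ns by (rule le_trans)
    qed
    show "spread ?\<kappa> (card ?I) ?I ?B" using n by (intro rainbow_cycles_spread) auto
  qed (use \<kappa> klog log5 s finite_all_edges in auto)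
  have ne: "n > 0" using n by simp
  \<comment> \<open>the expected number of coloured edges is at most \<open>m / 2\<close>\<close>
  have pn: "2 * (card ?E * (p * n)) \<le> m"
  proof -
    have "p * (real n)\<^sup>2 \<le> 612 * real k" using p ne by (simp add: field_simps)
    have "2 * (card ?E * (p * n)) = real (n * (n - 1)) * (p * n)"
    proof -
      have "even (n * (n - 1))" by (cases n) auto
      then have eq: "2 * (n choose 2) = n * (n - 1)"
        unfolding choose_two by (rule dvd_mult_div_cancel)
      have "2 * real (n choose 2) = real (2 * (n choose 2))" by simp
      then have "2 * real (n choose 2) = real (n * (n - 1))" by (simp only: eq)
      then show ?thesis unfolding card_all_edges by (simp only: flip: mult.assoc)
    qed
    also have "\<dots> \<le> (real n)\<^sup>2 * (p * n)"
    proof (rule mult_right_mono)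
      have "n * (n - 1) \<le> n * n" by simp
      then show "real (n * (n - 1)) \<le> (real n)\<^sup>2" by (metis of_nat_le_iff of_nat_mult power2_eq_square)
    qed (use p in simp)
    also have "\<dots> = (p * (real n)\<^sup>2) * n" by simp
    also have "\<dots> \<le> (612 * real k) * n"
      using \<open>p * (real n)\<^sup>2 \<le> 612 * real k\<close> by (intro mult_right_mono) auto
    also have "\<dots> \<le> (612 * (2.5 * ln n)) * n" using kln by (intro mult_right_mono) auto
    also have "\<dots> \<le> 2000 * real n * ln n" using ln ne by simp
    also have "\<dots> \<le> m" using m by simp
    finally show ?thesis .
  qed
  have m0: "0 < m"
  proof -
    have "0 < 2000 * real n * ln n" using n by (intro mult_pos_pos) simp_all
    then show ?thesis using m by linarith
  qed
  \<comment> \<open>as \<open>m\<close> is at most the number of all edges, the probabilities of the colours at an edge add up to at most \<open>1/2\<close>\<close>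
  have pn1: "p * card {1..n} \<le> 1"
  proof -
    have "0 < real (card ?E)" using n by (simp add: card_all_edges)
    moreover have "real m \<le> card ?E" using m by (simp add: card_all_edges)
    then have "2 * (card ?E * (p * n)) \<le> real (card ?E) * 1" using pn by linarith
    then have "real (card ?E) * (2 * (p * n)) \<le> real (card ?E) * 1" by (simp only: mult.left_commute)
    ultimately have "2 * (p * n) \<le> 1" by (simp only: mult_le_cancel_left_pos)
    then show ?thesis using p by simp
  qed
  have "1 - prob_rainbow_hamilton n m \<le> bad_ratio ?E {1..n} (?B ` ?I) m"
    using n m by (intro failure_le_bad_ratio) auto
  also have "\<dots> \<le> 2 * exclusive_exp p {1..n} ?E (misses (?B ` ?I))"
    using finite_all_edges m m0 p pn ne by (intro bad_ratio_le_exclusive) (auto simp: card_all_edges)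
  also have "exclusive_exp p {1..n} ?E (misses (?B ` ?I)) \<le> binomial_exp p (?E \<times> {1..n}) (misses (?B ` ?I))"
    using finite_all_edges p pn1 n rainbow_cycle_subset(3)
    by (intro exclusive_le_independent) auto
  also note cov
  also have "(1 + 1 / real k) ^ s - 1 + k / 4 ^ s \<le> 6 / s"
    using s(3) s2 by (rule rounds_error_le)
  also have "6 / real s \<le> 6 / (sqrt (log 2 n) - 1)"
  proof (rule divide_left_mono)
    have "sqrt (log 2 n) \<le> sqrt k" using klog by simp
    then show "sqrt (log 2 n) - 1 \<le> s" using s(2) by linarith
    have "1 < sqrt (log 2 n)" using log5 by simp
    then show "0 < real s * (sqrt (log 2 n) - 1)" using s by simp
  qed simp
  finally show ?thesis by simp
qed

lemma prob_rainbow_hamilton_tendsto_1: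
  assumes F: "F \<le> at_top"
    and m: "\<forall>\<^sub>F n in F. 2000 * real n * ln (real n) \<le> real (m n) \<and> m n \<le> n choose 2"
  shows "((\<lambda>n. prob_rainbow_hamilton n (m n)) \<longlongrightarrow> 1) F"
proof (rule tendsto_sandwich)
  have "filterlim (\<lambda>n::nat. inverse (ln 2) * ln (real n)) at_top at_top"
    by (intro filterlim_tendsto_pos_mult_at_top[OF tendsto_const]
        filterlim_compose[OF ln_at_top] filterlim_real_sequentially) auto
  then have "filterlim (\<lambda>n::nat. log 2 (real n)) at_top at_top"
    by (simp add: log_def field_simps)
  then have "filterlim (\<lambda>n::nat. - 1 + sqrt (log 2 (real n))) at_top at_top"
    by (intro filterlim_tendsto_add_at_top[OF tendsto_const] filterlim_compose[OF sqrt_at_top])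
  then have "((\<lambda>n::nat. 12 / (sqrt (log 2 (real n)) - 1)) \<longlongrightarrow> 0) at_top"
    by (intro real_tendsto_divide_at_top[OF tendsto_const]) simp
  then have "((\<lambda>n::nat. 1 - 12 / (sqrt (log 2 (real n)) - 1)) \<longlongrightarrow> 1 - 0) at_top"
    by (intro tendsto_diff tendsto_const)
  then show "((\<lambda>n::nat. 1 - 12 / (sqrt (log 2 (real n)) - 1)) \<longlongrightarrow> 1) F"
    using tendsto_mono[OF F] by simp
  have "\<forall>\<^sub>F n in F. 100 \<le> n" using F eventually_ge_at_top filter_leD by blast
  with m show "\<forall>\<^sub>F n in F. 1 - 12 / (sqrt (log 2 (real n)) - 1) \<le> prob_rainbow_hamilton n (m n)"
  proof eventually_elim
    case (elim n)
    then show ?case using failure_probability_le[of n "m n"] by simp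
  qed
  show "\<forall>\<^sub>F n in F. prob_rainbow_hamilton n (m n) \<le> 1"
    by (simp add: prob_rainbow_hamilton_def)
qed simp

theorem theorem1p4:
  shows "(\<exists>K::real. K > 0 \<and>
            (\<forall>m::nat \<Rightarrow> nat.
               (\<forall>\<^sub>F n in even_at_top. K * real n * ln (real n) \<le> real (m n) \<and> m n \<le> n choose 2) \<longrightarrow>
               ((\<lambda>n. prob_rainbow_hamilton n (m n)) \<longlongrightarrow> 1) even_at_top))
       \<and> (\<forall>(\<omega>::nat \<Rightarrow> real) (m::nat \<Rightarrow> nat).
            filterlim \<omega> at_top odd_at_top \<longrightarrow>
            (\<forall>\<^sub>F n in odd_at_top. real (m n) = \<omega> n * real n * ln (real n) \<and> m n \<le> n choose 2) \<longrightarrow>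
            ((\<lambda>n. prob_rainbow_hamilton n (m n)) \<longlongrightarrow> 1) odd_at_top)"
proof (intro conjI allI impI)
  have "even_at_top \<le> at_top" by (simp add: even_at_top_def)
  then show "\<exists>K::real. K > 0 \<and>
      (\<forall>m::nat \<Rightarrow> nat.
         (\<forall>\<^sub>F n in even_at_top. K * real n * ln (real n) \<le> real (m n) \<and> m n \<le> n choose 2) \<longrightarrow>
         ((\<lambda>n. prob_rainbow_hamilton n (m n)) \<longlongrightarrow> 1) even_at_top)"
    using prob_rainbow_hamilton_tendsto_1 by (intro exI[of _ 2000]) auto
next
  fix \<omega> :: "nat \<Rightarrow> real" and m :: "nat \<Rightarrow> nat"
  assume \<omega>: "filterlim \<omega> at_top odd_at_top"
    and m: "\<forall>\<^sub>F n in odd_at_top. real (m n) = \<omega> n * real n * ln (real n) \<and> m n \<le> n choose 2"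
  have odd: "odd_at_top \<le> at_top" by (simp add: odd_at_top_def)
  have "\<forall>\<^sub>F n in odd_at_top. 2000 \<le> \<omega> n" using \<omega> by (simp add: filterlim_at_top)
  moreover have "\<forall>\<^sub>F n in odd_at_top. 1 \<le> n" using odd eventually_ge_at_top filter_leD by blast
  ultimately have "\<forall>\<^sub>F n in odd_at_top. 2000 * real n * ln (real n) \<le> real (m n) \<and> m n \<le> n choose 2"
    using m
  proof eventually_elim
    case (elim n)
    then have "2000 * (real n * ln (real n)) \<le> \<omega> n * (real n * ln (real n))"
      by (intro mult_right_mono) auto
    then show ?case using elim by (simp add: mult.assoc)
  qed
  then show "((\<lambda>n. prob_rainbow_hamilton n (m n)) \<longlongrightarrow> 1) odd_at_top"
    by (rule prob_rainbow_hamilton_tendsto_1[OF odd])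
qed

end
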